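(* Let $n\in\mathbb N_0$, $\beta,\gamma\in(-1,1)\setminus\{0\}$, $0<|q|<1$, $|t|<\min\{(1-\beta^2)(1+\sqrt q|\beta|)(1-q|\gamma|),1\}$. Then, with $x=\cos\theta$, $$\int_{-1}^1{}_2\phi_1\!\left(\beta^{1/2}e^{i\theta},(q\beta)^{1/2}e^{i\theta};\beta q^{1/2};q,te^{-i\theta}\right)\,{}_2\phi_1\!\left(-\beta^{1/2}e^{-i\theta},-(q\beta)^{1/2}e^{-i\theta};\beta q^{1/2};q,te^{i\theta}\right)C_n(x;\gamma|q)\frac{w(x;\gamma|q)}{\sqrt{1-x^2}}\,dx$$ $$=2\pi t^n\frac{(\gamma,q\gamma;q)_\infty(\gamma^2,\pm\beta,-\beta q^{1/2};q)_n}{(\gamma^2,q;q)_\infty(\beta^2,\beta q^{1/2},q\gamma,q;q)_n}\,\Phi_n,$$ where $\Phi_n$ is the series ${}_{10}\phi_9$ with base $q$, argument $\gamma t^2$, upper parameters $$\beta\gamma^{-1},\ \beta q^n,\ \pm i(\beta q^n)^{1/2},\ \pm i(\beta q^{n+1})^{1/2},\ \pm i(\beta q^{n+1/2})^{1/2},\ \pm i(\beta q^{n+3/2})^{1/2},$$ and lower parameters $$\gamma q^{n+1},\ \pm\beta q^{n/2},\ \pm\beta q^{(n+1)/2},\ \pm(\beta q^{n+1/2})^{1/2},\ \pm(\beta q^{n+3/2})^{1/2}.$$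
   Context: Notation: $\mathbb N_0=\{0,1,2,\dots\}$, $(a;q)_0=1$, $(a;q)_n=\prod_{j=0}^{n-1}(1-aq^j)$, $(a;q)_\infty=\prod_{j\ge0}(1-aq^j)$, $(a_1,\dots,a_r;q)_n=\prod_i(a_i;q)_n$ (also for $n=\infty$). In a list of parameters, $\pm a$ stands for the two entries $a,-a$. Square roots are taken consistently: $(q\beta)^{1/2}=q^{1/2}\beta^{1/2}$. The basic hypergeometric series, with upper parameters listed before the first semicolon and lower parameters before the second, is $${}_r\phi_s(a_1,\dots,a_r;b_1,\dots,b_s;q,z)=\sum_{k=0}^\infty\frac{(a_1,\dots,a_r;q)_k}{(q,b_1,\dots,b_s;q)_k}\left((-1)^kq^{\binom k2}\right)^{1+s-r}z^k.$$ The continuous $q$-ultraspherical/Rogers polynomials are, for $x=\cos\theta$, $$C_n(x;\beta|q)=\frac{(\beta;q)_n}{(q;q)_n}e^{in\theta}\,{}_2\phi_1\!\left(q^{-n},\beta;\beta^{-1}q^{1-n};q,q\beta^{-1}e^{-2i\theta}\right),$$ and the weight function $w$ on $(-1,1)$ is $$w(x;\beta|q)=\left|\frac{(e^{2i\theta};q)_\infty}{(\beta e^{2i\theta};q)_\infty}\right|^2.$$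
   Formalization: Here q is real with 0<|q|<1: for non-real q the identity fails (at n=0, t=0 the left side is a positive real, the right side in general is not real). For q<0 the bound on |t|, which is then not a real number, is replaced by its modulus. *)

theory Defs
  imports "HOL-Analysis.Analysis"
begin

definition qpoch :: "complex \<Rightarrow> complex \<Rightarrow> nat \<Rightarrow> complex" where
  "qpoch a q n = (\<Prod>j<n. 1 - a * q ^ j)"

definition qpoch_inf :: "complex \<Rightarrow> complex \<Rightarrow> complex" where
  "qpoch_inf a q = prodinf (\<lambda>j. 1 - a * q ^ j)"

definition qpochs :: "complex list \<Rightarrow> complex \<Rightarrow> nat \<Rightarrow> complex" where
  "qpochs as q n = (\<Prod>a\<leftarrow>as. qpoch a q n)"

definition qpochs_inf :: "complex list \<Rightarrow> complex \<Rightarrow> complex" where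
  "qpochs_inf as q = (\<Prod>a\<leftarrow>as. qpoch_inf a q)"

text \<open>The exponent \<open>1 + s - r\<close> of the usual definition can be negative, hence the integer power.
  In a terminating series the summands beyond the last term vanish, even if a factor
  of the denominator vanishes there, since division by zero yields zero.\<close>

definition qhyp ::
  "complex list \<Rightarrow> complex list \<Rightarrow> complex \<Rightarrow> complex \<Rightarrow> complex" where
  "qhyp as bs q z =
    (\<Sum>k. qpochs as q k / qpochs (q # bs) q k
         * ((- 1) ^ k * q ^ (k choose 2)) powi (1 + int (length bs) - int (length as)) * z ^ k)"

definition rogers_poly :: "nat \<Rightarrow> real \<Rightarrow> complex \<Rightarrow> complex \<Rightarrow> complex" where
  "rogers_poly n x \<beta> q =
    (let \<theta> = arccos x in
      qpoch \<beta> q n / qpoch q q n * cis (real n * \<theta>)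
      * qhyp [q powi (- int n), \<beta>] [inverse \<beta> * q powi (1 - int n)] q
             (q * inverse \<beta> * cis (- 2 * \<theta>)))"

definition rogers_weight :: "real \<Rightarrow> complex \<Rightarrow> complex \<Rightarrow> real" where
  "rogers_weight x \<beta> q =
    (let \<theta> = arccos x in
      (cmod (qpoch_inf (cis (2 * \<theta>)) q / qpoch_inf (\<beta> * cis (2 * \<theta>)) q))\<^sup>2)"

abbreviation pm :: "complex \<Rightarrow> complex list" where
  "pm a \<equiv> [a, - a]"

text \<open>The series \<open>\<Phi>\<^sub>n\<close>; half-integer powers of \<open>q\<close> are powers of \<open>csqrt q\<close>. The outer square
  roots occur only with both signs, so their choice is immaterial.\<close>

definition Phi_series :: "nat \<Rightarrow> complex \<Rightarrow> complex \<Rightarrow> complex \<Rightarrow> complex \<Rightarrow> complex" where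
  "Phi_series n \<beta> \<gamma> q t = qhyp
    ([\<beta> * inverse \<gamma>, \<beta> * q ^ n]
      @ pm (\<i> * csqrt (\<beta> * q ^ n))
      @ pm (\<i> * csqrt (\<beta> * q ^ (n + 1)))
      @ pm (\<i> * csqrt (\<beta> * csqrt q ^ (2 * n + 1)))
      @ pm (\<i> * csqrt (\<beta> * csqrt q ^ (2 * n + 3))))
    ([\<gamma> * q ^ (n + 1)]
      @ pm (\<beta> * csqrt q ^ n)
      @ pm (\<beta> * csqrt q ^ (n + 1))
      @ pm (csqrt (\<beta> * csqrt q ^ (2 * n + 1)))
      @ pm (csqrt (\<beta> * csqrt q ^ (2 * n + 3))))
    q (\<gamma> * t\<^sup>2)"

text \<open>The integrand, with \<open>x = cos \<theta>\<close>; the root of \<open>q \<beta>\<close> is \<open>csqrt q * csqrt \<beta>\<close>.\<close>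

definition rogers_integrand ::
  "nat \<Rightarrow> complex \<Rightarrow> complex \<Rightarrow> complex \<Rightarrow> complex \<Rightarrow> real \<Rightarrow> complex" where
  "rogers_integrand n \<beta> \<gamma> q t x =
    (let \<theta> = arccos x in
      qhyp [csqrt \<beta> * cis \<theta>, csqrt q * csqrt \<beta> * cis \<theta>]
           [\<beta> * csqrt q] q (t * cis (- \<theta>))
      * qhyp [- csqrt \<beta> * cis (- \<theta>), - (csqrt q * csqrt \<beta>) * cis (- \<theta>)]
             [\<beta> * csqrt q] q (t * cis \<theta>)
      * rogers_poly n x \<gamma> q
      * complex_of_real (rogers_weight x \<gamma> q / sqrt (1 - x\<^sup>2)))"

end

theory Submission
  imports Defs
begin

text \<open>
  Write \<open>z = e\<^sup>i\<^sup>\<theta>\<close> and let \<open>C\<^sub>n(\<beta>)\<close> be the Rogers polynomials. Up to the weight, the integrand is the product of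
  a generating function and a polynomial \<open>C\<^sub>n(\<gamma>)\<close>, and the theorem is the result of termwise integration. Three
  facts carry it.

  The product of the two series in the integrand is a generating function of the polynomials \<open>C\<^sub>m(\<beta>)\<close>, with the
  coefficients \<open>(-\<beta>, -\<beta> q\<^sup>1\<^sup>/\<^sup>2; q)\<^sub>m / (\<beta>\<^sup>2, \<beta> q\<^sup>1\<^sup>/\<^sup>2; q)\<^sub>m\<close> (\<open>prod_coeff_eq_rogers\<close>, \<open>generating_function\<close>). Both the
  coefficients of the product and the Rogers polynomials are mapped by the divided difference
  \<open>f(q\<^sup>1\<^sup>/\<^sup>2 z) - f(q\<^sup>-\<^sup>1\<^sup>/\<^sup>2 z)\<close> to multiples of their predecessors with \<open>q \<beta>\<close> in place of \<open>\<beta>\<close>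
  (\<open>prod_coeff_lowering\<close>, \<open>rogers_hom_lowering\<close>). A Laurent polynomial annihilated by this operator is constant,
  so an induction and the value at a single point, \<open>z = \<beta>\<^sup>-\<^sup>1\<^sup>/\<^sup>2\<close>, identify them.

  The moments of the weight for \<open>\<gamma>\<close> follow from the \<open>q\<close>-binomial theorem: once a factor \<open>1 - e\<^sup>-\<^sup>2\<^sup>i\<^sup>\<theta>\<close> is
  split off, the Laurent coefficients of the cofactor satisfy a first-order recurrence, and the limit of the
  recurrence determines the total mass (\<open>reduced_term_suminf_0\<close>, \<open>half_moment_difference\<close>, \<open>density_moment\<close>).

  The mixed moments, the integrals of \<open>C\<^sub>m(\<beta>) C\<^sub>n(\<gamma>)\<close> against the weight for \<open>\<gamma>\<close>, have a closed form
  (\<open>mixed_moment_eq\<close>), which combines the orthogonality relation with Rogers' connection formula. The three-term recurrences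
  in \<open>m\<close> and in \<open>n\<close> give a relation between four neighbouring mixed moments, which the closed form satisfies as
  well, and which determines a table from its first column or from its first row. For \<open>\<beta> = q\<close> the
  polynomials \<open>C\<^sub>m(\<beta>)\<close> are Chebyshev polynomials, and the first column is a telescoping sum of moments. This
  settles the table for \<open>\<beta> = q\<close>, in particular its first row; but that row does not depend on \<open>\<beta>\<close>, and
  so determines the table for every \<open>\<beta>\<close>.

  Only the mixed moments with \<open>m = n + 2 k\<close> are nonzero. The symbols of index \<open>n + 2 k\<close> in them split into a
  symbol of index \<open>n\<close> and four of index \<open>k\<close>, whose parameters are square roots with both signs
  (\<open>qpoch_add_double\<close>); this is the series \<open>\<Phi>\<^sub>n\<close>.
\<close>

unbundle no vec_syntax
unbundle fps_syntax

section \<open>Rogers polynomials as formal coefficients\<close>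

lemma qpoch_Suc: "qpoch a q (Suc n) = qpoch a q n * (1 - a * q ^ n)"
  by (simp add: qpoch_def)

lemma qpoch_0 [simp]: "qpoch a q 0 = 1"
  by (simp add: qpoch_def)

lemma norm_mult_power_less_one:
  fixes a q :: complex
  assumes "norm a < 1" "norm q < 1"
  shows "norm (a * q ^ k) < 1"
proof -
  have "norm q ^ k \<le> 1"
    using assms(2) by (simp add: power_le_one)
  then have "norm a * norm q ^ k \<le> norm a * 1"
    by (intro mult_left_mono) auto
  then show ?thesis
    using assms(1) by (simp add: norm_mult norm_power)
qed

lemma one_minus_nonzero: "norm (a :: complex) < 1 \<Longrightarrow> 1 - a \<noteq> 0"
  by auto

lemma one_minus_mult_power_nonzero:
  fixes a q :: complex
  assumes "norm a < 1" "norm q < 1"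
  shows "1 - a * q ^ k \<noteq> 0"
  using one_minus_nonzero[OF norm_mult_power_less_one[OF assms]] .

lemma one_minus_power_Suc_nonzero:
  fixes q :: complex
  assumes "norm q < 1"
  shows "1 - q ^ Suc k \<noteq> 0"
  using one_minus_mult_power_nonzero[OF assms assms, of k] by simp

lemma qpoch_nonzero:
  assumes "norm a < 1" "norm q < 1"
  shows "qpoch a q n \<noteq> 0"
  using one_minus_mult_power_nonzero[OF assms] by (simp add: qpoch_def)

text \<open>The coefficients of the series for \<open>(b u; q)\<^sub>\<infinity> / (c u; q)\<^sub>\<infinity>\<close>. With two parameters instead of the quotient
  \<open>b / c\<close>, the expressions \<open>(b / c; q)\<^sub>k c\<^sup>k\<close> of the classical formulas become division-free products.\<close>

definition qbin :: "complex \<Rightarrow> complex \<Rightarrow> complex \<Rightarrow> nat \<Rightarrow> complex" where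
  "qbin b c q k = (\<Prod>j<k. c - b * q ^ j) / qpoch q q k"

lemma qbin_0 [simp]: "qbin b c q 0 = 1"
  by (simp add: qbin_def)

lemma qbin_one: "qbin b 1 q k = qpoch b q k / qpoch q q k"
  by (simp add: qbin_def qpoch_def)

lemma qbin_Suc:
  assumes "norm q < 1"
  shows "qbin b c q (Suc k) * (1 - q ^ Suc k) = qbin b c q k * (c - b * q ^ k)"
  using one_minus_power_Suc_nonzero[OF assms, of k] qpoch_nonzero[OF assms assms]
  by (simp add: qbin_def qpoch_Suc field_simps)

definition qbin_fps :: "complex \<Rightarrow> complex \<Rightarrow> complex \<Rightarrow> complex fps" where
  "qbin_fps b q z = Abs_fps (\<lambda>k. qbin b 1 q k * z ^ k)"

abbreviation lin_fps :: "complex \<Rightarrow> complex fps" where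
  "lin_fps a \<equiv> 1 - fps_const a * fps_X"

lemma lin_fps_mult_nth_Suc:
  "(lin_fps a * F) $ Suc n = F $ Suc n - a * F $ n"
  by (simp add: left_diff_distrib mult.assoc)

lemma lin_fps_mult_nth_Suc_Suc:
  "(lin_fps a * lin_fps b * F) $ Suc (Suc n)
    = F $ Suc (Suc n) - (a + b) * F $ Suc n + a * b * F $ n"
  by (simp add: lin_fps_mult_nth_Suc mult.assoc) (simp add: algebra_simps)

text \<open>The \<open>q\<close>-difference equation \<open>(1 - z T) A(z T) = (1 - b z T) A(q z T)\<close> for
  \<open>A(T) = (b T; q)\<^sub>\<infinity> / (T; q)\<^sub>\<infinity>\<close>, as an identity of formal power series. All algebraic properties of
  the Rogers polynomials below are consequences of it.\<close>

lemma qbin_fps_qdiff: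
  assumes "norm q < 1"
  shows "lin_fps z * qbin_fps b q z = lin_fps (b * z) * qbin_fps b q (q * z)"
proof (rule fps_ext)
  fix n
  show "(lin_fps z * qbin_fps b q z) $ n = (lin_fps (b * z) * qbin_fps b q (q * z)) $ n"
  proof (cases n)
    case 0
    then show ?thesis by (simp add: qbin_fps_def)
  next
    case (Suc k)
    have "qbin b 1 q (Suc k) - qbin b 1 q k = q ^ Suc k * qbin b 1 q (Suc k) - b * q ^ k * qbin b 1 q k"
      using qbin_Suc[OF assms, of b 1 k] by (simp add: algebra_simps)
    then have "(qbin b 1 q (Suc k) - qbin b 1 q k) * z ^ Suc k
        = (q ^ Suc k * qbin b 1 q (Suc k) - b * q ^ k * qbin b 1 q k) * z ^ Suc k"
      by simp
    then show ?thesis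
      unfolding Suc lin_fps_mult_nth_Suc
      by (simp add: qbin_fps_def algebra_simps power_mult_distrib)
  qed
qed

text \<open>Replacing \<open>b\<close> by \<open>q b\<close> deletes the first factor of \<open>(b T; q)\<^sub>\<infinity>\<close>; replacing \<open>T\<close> by \<open>q T\<close> deletes the
  first factor of numerator and denominator.\<close>

lemma qbin_fps_shift_b:
  assumes "norm q < 1"
  shows "lin_fps (b * z) * qbin_fps (q * b) q z = qbin_fps b q z"
    "lin_fps z * qbin_fps (q * b) q z = qbin_fps b q (q * z)"
proof -
  have step: "qbin (q * b) 1 q (Suc k) * (1 - q ^ Suc k) = qbin (q * b) 1 q k * (1 - q * b * q ^ k)" for k
    by (rule qbin_Suc[OF assms])
  have rel: "qbin b 1 q k * (1 - b * q ^ k) = qbin (q * b) 1 q k * (1 - b)" for k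
  proof -
    have "qpoch b q k * (1 - b * q ^ k) = qpoch (q * b) q k * (1 - b)"
    proof (induction k)
      case (Suc k)
      have "qpoch b q (Suc k) * (1 - b * q ^ Suc k) = (qpoch b q k * (1 - b * q ^ k)) * (1 - b * q ^ Suc k)"
        by (simp add: qpoch_Suc)
      also have "\<dots> = qpoch (q * b) q (Suc k) * (1 - b)"
        unfolding Suc by (simp add: qpoch_Suc ac_simps)
      finally show ?case .
    qed simp
    then show ?thesis by (simp add: qbin_one)
  qed
  have coeff: "qbin (q * b) 1 q (Suc k) - b * qbin (q * b) 1 q k = qbin b 1 q (Suc k)" for k
  proof -
    have nz: "1 - q ^ Suc k \<noteq> 0"
      by (rule one_minus_power_Suc_nonzero[OF assms])
    have "(qbin (q * b) 1 q (Suc k) - b * qbin (q * b) 1 q k) * (1 - q ^ Suc k)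
        = qbin (q * b) 1 q k * (1 - b)"
      using step[of k] by (simp add: algebra_simps)
    also have "\<dots> = qbin b 1 q (Suc k) * (1 - q ^ Suc k)"
      using rel[of k] qbin_Suc[OF assms, of b 1 k] by simp
    finally show ?thesis using nz by simp
  qed
  show *: "lin_fps (b * z) * qbin_fps (q * b) q z = qbin_fps b q z"
  proof (rule fps_ext)
    fix n
    show "(lin_fps (b * z) * qbin_fps (q * b) q z) $ n = qbin_fps b q z $ n"
    proof (cases n)
      case 0
      then show ?thesis by (simp add: qbin_fps_def)
    next
      case (Suc k)
      show ?thesis
        unfolding Suc lin_fps_mult_nth_Suc
        using arg_cong[OF coeff[of k], of "\<lambda>x. x * z ^ Suc k"]
        by (simp add: qbin_fps_def algebra_simps)
    qed
  qed
  have "lin_fps (b * z) * (lin_fps z * qbin_fps (q * b) q z) = lin_fps (b * z) * qbin_fps b q (q * z)"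
    using qbin_fps_qdiff[OF assms, of z b] by (simp add: * [symmetric] ac_simps)
  moreover have "lin_fps (b * z) \<noteq> 0"
  proof
    assume "lin_fps (b * z) = 0"
    then have "lin_fps (b * z) $ 0 = 0" by simp
    then show False by simp
  qed
  ultimately show "lin_fps z * qbin_fps (q * b) q z = qbin_fps b q (q * z)"
    by simp
qed

text \<open>The Rogers polynomial in the two variables \<open>z = e\<^sup>i\<^sup>\<theta>\<close> and \<open>w = e\<^sup>-\<^sup>i\<^sup>\<theta>\<close>, which are kept independent:
  homogeneity then turns the substitution \<open>z \<rightarrow> q\<^sup>1\<^sup>/\<^sup>2 z\<close>, \<open>w \<rightarrow> q\<^sup>-\<^sup>1\<^sup>/\<^sup>2 w\<close> into \<open>z \<rightarrow> q z\<close>, up to a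
  factor, so that the lowering relation is polynomial in \<open>q\<close>, \<open>z\<close> and \<open>w\<close>, up to the denominators of the coefficients.\<close>

definition rogers_hom :: "complex \<Rightarrow> complex \<Rightarrow> nat \<Rightarrow> complex \<Rightarrow> complex \<Rightarrow> complex" where
  "rogers_hom b q n z w = (\<Sum>k\<le>n. qbin b 1 q k * qbin b 1 q (n - k) * z ^ (n - k) * w ^ k)"

lemma qbin_fps_mult_nth: "(qbin_fps b q w * qbin_fps b q z) $ n = rogers_hom b q n z w"
  by (simp add: fps_mult_nth qbin_fps_def rogers_hom_def atLeast0AtMost ac_simps)

lemma rogers_hom_scale: "rogers_hom b q n (c * z) (c * w) = c ^ n * rogers_hom b q n z w"
proof -
  have "c ^ n = c ^ (n - k) * c ^ k" if "k \<le> n" for k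
    using that by (simp flip: power_add)
  then show ?thesis
    unfolding rogers_hom_def sum_distrib_left
    by (intro sum.cong) (auto simp: power_mult_distrib)
qed

lemma rogers_hom_commute: "rogers_hom b q n z w = rogers_hom b q n w z"
  by (metis mult.commute qbin_fps_mult_nth)

lemma rogers_hom_0 [simp]: "rogers_hom b q 0 z w = 1"
  by (simp add: rogers_hom_def)

text \<open>Compare coefficients in \<open>(1 - z T) (1 - w T) G(T) = (1 - b z T) (1 - b w T) G(q T)\<close> for the generating
  function \<open>G\<close> of the polynomials, where \<open>G(q T)\<close> has the coefficients \<open>q\<^sup>n R\<^sub>n\<close> by homogeneity.\<close>

lemma rogers_hom_recurrence:
  assumes "norm q < 1"
  shows "(1 - q ^ Suc (Suc n)) * rogers_hom b q (Suc (Suc n)) z w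
    = (z + w) * (1 - b * q ^ Suc n) * rogers_hom b q (Suc n) z w
      - z * w * (1 - b\<^sup>2 * q ^ n) * rogers_hom b q n z w"
proof -
  let ?G = "qbin_fps b q w * qbin_fps b q z" and ?H = "qbin_fps b q (q * w) * qbin_fps b q (q * z)"
  have "lin_fps w * lin_fps z * ?G = (lin_fps w * qbin_fps b q w) * (lin_fps z * qbin_fps b q z)"
    by (simp add: ac_simps)
  also have "\<dots> = lin_fps (b * w) * lin_fps (b * z) * ?H"
    unfolding qbin_fps_qdiff[OF assms, of w b] qbin_fps_qdiff[OF assms, of z b]
    by (simp only: ac_simps)
  finally have "(lin_fps w * lin_fps z * ?G) $ Suc (Suc n)
      = (lin_fps (b * w) * lin_fps (b * z) * ?H) $ Suc (Suc n)" by simp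
  then show ?thesis
    unfolding lin_fps_mult_nth_Suc_Suc qbin_fps_mult_nth rogers_hom_scale
    by (simp add: algebra_simps power2_eq_square)
qed

lemma rogers_hom_1:
  assumes "norm q < 1"
  shows "(1 - q) * rogers_hom b q 1 z w = (1 - b) * (z + w)"
proof -
  have "qbin b 1 q 1 * (1 - q) = 1 - b"
    using qbin_Suc[OF assms, of b 1 0] by simp
  then have "qbin b 1 q 1 * (1 - q) * (z + w) = (1 - b) * (z + w)"
    by simp
  then show ?thesis
    by (simp add: rogers_hom_def algebra_simps)
qed

text \<open>The divided difference operator of Askey and Wilson lowers the degree and raises \<open>b\<close> to \<open>q b\<close>. Both
  generating functions on the left are multiples of the one on the right, and the difference of the
  multipliers is \<open>(1 - z T) (1 - b w T) - (1 - b z T) (1 - w T) = - (1 - b) (z - w) T\<close>.\<close>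

lemma rogers_hom_lowering:
  assumes "norm q < 1"
  shows "rogers_hom b q (Suc n) (q * z) w - rogers_hom b q (Suc n) z (q * w)
    = - (1 - b) * (z - w) * rogers_hom (q * b) q n z w"
proof -
  let ?P = "qbin_fps (q * b) q w * qbin_fps (q * b) q z"
  have "qbin_fps b q w * qbin_fps b q (q * z) - qbin_fps b q (q * w) * qbin_fps b q z
      = (lin_fps (b * w) * lin_fps z - lin_fps w * lin_fps (b * z)) * ?P"
    unfolding qbin_fps_shift_b(1)[OF assms, of b z, symmetric] qbin_fps_shift_b(1)[OF assms, of b w, symmetric]
      qbin_fps_shift_b(2)[OF assms, of z b, symmetric] qbin_fps_shift_b(2)[OF assms, of w b, symmetric]
    by (simp only: algebra_simps)
  also have "lin_fps (b * w) * lin_fps z - lin_fps w * lin_fps (b * z)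
      = fps_X * fps_const (- (1 - b) * (z - w))"
  proof -
    have "lin_fps (b * w) * lin_fps z - lin_fps w * lin_fps (b * z)
      = fps_X * (fps_const w + fps_const (b * z) - fps_const (b * w) - fps_const z)
        + fps_X^2 * (fps_const (b * w) * fps_const z - fps_const w * fps_const (b * z))"
      by (simp add: algebra_simps power2_eq_square del: fps_const_mult)
    also have "\<dots> = fps_X * fps_const (w + b * z - b * w - z)"
      by simp
    also have "w + b * z - b * w - z = - (1 - b) * (z - w)"
      by (simp add: algebra_simps)
    finally show ?thesis .
  qed
  also have "fps_X * fps_const (- (1 - b) * (z - w)) * ?P = fps_X * (fps_const (- (1 - b) * (z - w)) * ?P)"
    by (simp only: mult.assoc)
  finally have "(qbin_fps b q w * qbin_fps b q (q * z) - qbin_fps b q (q * w) * qbin_fps b q z) $ Suc n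
      = (fps_X * (fps_const (- (1 - b) * (z - w)) * ?P)) $ Suc n"
    by simp
  then show ?thesis
    by (simp add: qbin_fps_mult_nth mult.assoc del: fps_const_mult fps_const_neg)
qed

text \<open>At this argument the two factors of the generating function telescope to
  \<open>(b\<^sup>2 T; q)\<^sub>\<infinity> / (T; q)\<^sub>\<infinity>\<close>.\<close>

lemma rogers_hom_special_value:
  assumes "norm q < 1"
  shows "rogers_hom b q n 1 b = qpoch (b\<^sup>2) q n / qpoch q q n"
proof -
  let ?F = "qbin_fps b q b * qbin_fps b q 1" and ?H = "qbin_fps b q (q * b) * qbin_fps b q (q * 1)"
  have "lin_fps b * (lin_fps 1 * ?F) = (lin_fps b * qbin_fps b q b) * (lin_fps 1 * qbin_fps b q 1)"
    by (simp add: ac_simps)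
  also have "\<dots> = lin_fps b * (lin_fps (b * b) * ?H)"
    unfolding qbin_fps_qdiff[OF assms, of b b] qbin_fps_qdiff[OF assms, of 1 b] mult_1_right
    by (simp only: ac_simps)
  finally have "lin_fps b * (lin_fps 1 * ?F) = lin_fps b * (lin_fps (b * b) * ?H)" .
  moreover have "lin_fps b \<noteq> 0"
  proof
    assume "lin_fps b = 0"
    then have "lin_fps b $ 0 = 0" by simp
    then show False by simp
  qed
  ultimately have "lin_fps 1 * ?F = lin_fps (b * b) * ?H"
    by (metis mult_cancel_left)
  then have *: "(lin_fps 1 * ?F) $ Suc k = (lin_fps (b * b) * ?H) $ Suc k" for k
    by simp
  have rec: "rogers_hom b q (Suc k) 1 b * (1 - q ^ Suc k) = rogers_hom b q k 1 b * (1 - b\<^sup>2 * q ^ k)" for k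
    using *[of k] unfolding lin_fps_mult_nth_Suc qbin_fps_mult_nth rogers_hom_scale
    by (simp add: algebra_simps power2_eq_square)
  show ?thesis
  proof (induction n)
    case (Suc k)
    have "rogers_hom b q (Suc k) 1 b = rogers_hom b q k 1 b * (1 - b\<^sup>2 * q ^ k) / (1 - q ^ Suc k)"
      using rec[of k] one_minus_power_Suc_nonzero[OF assms, of k] by (metis nonzero_eq_divide_eq)
    then show ?case
      unfolding Suc by (simp add: qpoch_Suc)
  qed simp
qed

section \<open>The product of the two basic hypergeometric series\<close>

text \<open>With \<open>p = q\<^sup>1\<^sup>/\<^sup>2\<close> and \<open>s = \<beta>\<^sup>1\<^sup>/\<^sup>2\<close>, this is the denominator \<open>(\<beta> q\<^sup>1\<^sup>/\<^sup>2, q; q)\<^sub>k\<close> of both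
  series. Base \<open>p\<close> is used because the numerators combine to \<open>(s z, p s z; p\<^sup>2)\<^sub>k = (s z; p)\<^sub>2\<^sub>k\<close>.\<close>

definition prod_denom :: "complex \<Rightarrow> complex \<Rightarrow> nat \<Rightarrow> complex" where
  "prod_denom s p k = qpoch (s\<^sup>2 * p) (p\<^sup>2) k * qpoch (p\<^sup>2) (p\<^sup>2) k"

text \<open>The coefficient of \<open>t\<^sup>n\<close> in the product of the two series of the integrand, at \<open>z = e\<^sup>i\<^sup>\<theta>\<close>.\<close>

definition prod_coeff :: "complex \<Rightarrow> complex \<Rightarrow> nat \<Rightarrow> complex \<Rightarrow> complex" where
  "prod_coeff s p n z = (\<Sum>k\<le>n. qpoch (s * z) p (2 * k) * inverse z ^ k
      * (qpoch (- s * inverse z) p (2 * (n - k)) * z ^ (n - k))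
      / (prod_denom s p k * prod_denom s p (n - k)))"

lemma qpoch_shift: "qpoch a q (Suc n) = (1 - a) * qpoch (a * q) q n"
  unfolding qpoch_def prod.lessThan_Suc_shift by (simp add: mult.assoc)

lemma qpoch_add: "qpoch a q (m + n) = qpoch a q m * qpoch (a * q ^ m) q n"
  by (induction n) (simp_all add: qpoch_Suc power_add mult.assoc)

lemma qpoch_double: "qpoch a p (2 * k) = qpoch a (p\<^sup>2) k * qpoch (a * p) (p\<^sup>2) k"
proof (induction k)
  case (Suc k)
  have "qpoch a p (2 * Suc k) = qpoch a p (2 * k) * (1 - a * p ^ (2 * k)) * (1 - a * p * p ^ (2 * k))"
    by (simp add: qpoch_Suc mult.assoc)
  also have "p ^ (2 * k) = (p\<^sup>2) ^ k"
    by (rule power_mult)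
  finally show ?case
    unfolding Suc by (simp add: qpoch_Suc)
qed simp

lemma norm_square_less_one: "norm (p :: complex) < 1 \<Longrightarrow> norm (p\<^sup>2) < 1"
  by (simp add: norm_power power_less_one_iff)

lemma norm_mult_less_one:
  fixes a b :: complex
  assumes "norm a < 1" "norm b < 1"
  shows "norm (a * b) < 1"
  using norm_mult_power_less_one[OF assms, of 1] by simp

lemma prod_denom_nonzero:
  assumes "norm p < 1" "norm s < 1"
  shows "prod_denom s p k \<noteq> 0"
  using assms
  by (simp add: prod_denom_def qpoch_nonzero norm_square_less_one norm_mult_less_one)

lemma prod_denom_Suc:
  "prod_denom s p (Suc k) = prod_denom s p k * (1 - s\<^sup>2 * p * (p ^ k)\<^sup>2) * (1 - p\<^sup>2 * (p ^ k)\<^sup>2)"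
  by (simp add: prod_denom_def qpoch_Suc ac_simps flip: power_mult)

lemma prod_denom_shift:
  "prod_denom (s * p) p k * (1 - s\<^sup>2 * p) = prod_denom s p k * (1 - s\<^sup>2 * p * (p ^ k)\<^sup>2)"
proof -
  have "(1 - s\<^sup>2 * p) * qpoch ((s * p)\<^sup>2 * p) (p\<^sup>2) k = qpoch (s\<^sup>2 * p) (p\<^sup>2) (Suc k)"
    by (simp add: qpoch_shift power_mult_distrib ac_simps)
  also have "\<dots> = qpoch (s\<^sup>2 * p) (p\<^sup>2) k * (1 - s\<^sup>2 * p * (p ^ k)\<^sup>2)"
    by (simp add: qpoch_Suc flip: power_mult) (simp add: mult.commute)
  finally show ?thesis
    by (simp add: prod_denom_def) (metis mult.assoc mult.commute)
qed

text \<open>The rational identity behind the next lemma, with \<open>K = p\<^sup>k\<close> and \<open>L = p\<^sup>n\<^sup>-\<^sup>1\<^sup>-\<^sup>k\<close>. The first two summands come from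
  the shifts \<open>z \<rightarrow> p z\<close> and \<open>z \<rightarrow> z / p\<close>, the bracket from a telescoping sum that cancels the terms
  which are constant in \<open>z\<close>; what is left is a multiple of \<open>z - 1 / z\<close>.\<close>

lemma prod_coeff_lowering_term:
  fixes s p z K L d e :: complex
  assumes "z \<noteq> 0" "p \<noteq> 0" "K \<noteq> 0" "L \<noteq> 0" "d \<noteq> 0" "e \<noteq> 0"
    and "1 - s\<^sup>2 * p * K\<^sup>2 \<noteq> 0" "1 - p\<^sup>2 * K\<^sup>2 \<noteq> 0"
    and "1 - s\<^sup>2 * p * L\<^sup>2 \<noteq> 0" "1 - p\<^sup>2 * L\<^sup>2 \<noteq> 0"
  shows
   "(1 + s / (p * z)) * (1 + s / z) * z * p * L / K / (d * (e * (1 - s\<^sup>2 * p * L\<^sup>2) * (1 - p\<^sup>2 * L\<^sup>2)))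
    - (1 - s * z / p) * (1 - s * z) / z * (p * K / L) / ((d * (1 - s\<^sup>2 * p * K\<^sup>2) * (1 - p\<^sup>2 * K\<^sup>2)) * e)
    + ((1 - s * z * p * K\<^sup>2) * (1 - s * z * p\<^sup>2 * K\<^sup>2) / z / ((d * (1 - s\<^sup>2 * p * K\<^sup>2) * (1 - p\<^sup>2 * K\<^sup>2)) * e)
      - (1 + s * p * L\<^sup>2 / z) * (1 + s * p\<^sup>2 * L\<^sup>2 / z) * z / (d * (e * (1 - s\<^sup>2 * p * L\<^sup>2) * (1 - p\<^sup>2 * L\<^sup>2))))
      / (p * K * L)
    = - (1 - s ^ 4 * p\<^sup>2 * K\<^sup>2 * L\<^sup>2) * (z - 1 / z) / (p * K * L)
      / (d * (1 - s\<^sup>2 * p * K\<^sup>2) * (e * (1 - s\<^sup>2 * p * L\<^sup>2)))"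
  (is "?t1 / (d * (e * ?C * ?D)) - ?t2 / ((d * ?A * ?B) * e)
      + (?t3 / ((d * ?A * ?B) * e) - ?t4 / (d * (e * ?C * ?D))) / ?M = ?rhs")
proof -
  have a: "?t1 * ?M - ?t4 = (s\<^sup>2 * p * L\<^sup>2 / z - z) * ?D"
    using assms(1-4) by (simp add: field_simps power2_eq_square)
  have b: "?t3 - ?t2 * ?M = (1 / z - s\<^sup>2 * p * K\<^sup>2 * z) * ?B"
    using assms(1-4) by (simp add: field_simps power2_eq_square)
  have "?M \<noteq> 0" using assms by simp
  then have "?t1 / (d * (e * ?C * ?D)) - ?t2 / ((d * ?A * ?B) * e)
      + (?t3 / ((d * ?A * ?B) * e) - ?t4 / (d * (e * ?C * ?D))) / ?M
    = ((?t1 * ?M - ?t4) / (d * (e * ?C * ?D)) + (?t3 - ?t2 * ?M) / ((d * ?A * ?B) * e)) / ?M"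
    by (simp only: add_divide_distrib diff_divide_distrib) (simp add: ac_simps)
  also have "\<dots> = ((s\<^sup>2 * p * L\<^sup>2 / z - z) / (d * (e * ?C)) + (1 / z - s\<^sup>2 * p * K\<^sup>2 * z) / (d * ?A * e)) / ?M"
    unfolding a b using assms(8,10) by simp
  also have "(s\<^sup>2 * p * L\<^sup>2 / z - z) / (d * (e * ?C)) + (1 / z - s\<^sup>2 * p * K\<^sup>2 * z) / (d * ?A * e)
    = ((s\<^sup>2 * p * L\<^sup>2 / z - z) * ?A + (1 / z - s\<^sup>2 * p * K\<^sup>2 * z) * ?C) / (d * ?A * (e * ?C))"
    using assms(5,6,7,9) by (simp add: add_divide_distrib)
  also have "(s\<^sup>2 * p * L\<^sup>2 / z - z) * ?A + (1 / z - s\<^sup>2 * p * K\<^sup>2 * z) * ?C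
    = - (1 - s ^ 4 * p\<^sup>2 * K\<^sup>2 * L\<^sup>2) * (z - 1 / z)"
    using assms(1) by (simp add: field_simps power2_eq_square power4_eq_xxxx)
  finally show ?thesis by (simp add: ac_simps)
qed

lemma qpoch_shift2: "qpoch a p (2 * Suc l) = (1 - a) * (1 - a * p) * qpoch (a * p * p) p (2 * l)"
proof -
  have "2 * Suc l = Suc (Suc (2 * l))" by simp
  then show ?thesis by (simp only: qpoch_shift mult.assoc)
qed

lemma qpoch_Suc2: "qpoch a p (2 * Suc l) = qpoch a p (2 * l) * (1 - a * (p ^ l)\<^sup>2) * (1 - a * p * (p ^ l)\<^sup>2)"
proof -
  have "2 * Suc l = Suc (Suc (2 * l))" by simp
  then show ?thesis by (simp add: qpoch_Suc mult.assoc flip: power_mult) (simp add: mult.commute)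
qed

text \<open>The product coefficients obey the same lowering relation as the Rogers polynomials. The summands of the
  right-hand side arise termwise, once the total difference of
  \<open>G k = p\<^sup>-\<^sup>n (p s z; p)\<^sub>2\<^sub>k (- p s / z; p)\<^sub>2\<^sub>(\<^sub>n\<^sub>-\<^sub>k\<^sub>) z\<^sup>n\<^sup>-\<^sup>2\<^sup>k / (d k d (n - k))\<close>, \<open>d\<close> the denominators, is added;
  its end points are the two boundary terms which have no partner.\<close>

lemma prod_coeff_lowering:
  fixes s p z :: complex
  assumes p: "norm p < 1" "p \<noteq> 0" and s: "norm s < 1" and z: "z \<noteq> 0"
  shows "prod_coeff s p (Suc N) (p * z) - prod_coeff s p (Suc N) (z / p)
    = - (1 - s ^ 4 * (p\<^sup>2) ^ Suc N) / (1 - s\<^sup>2 * p)\<^sup>2 / p ^ Suc N * (z - 1 / z) * prod_coeff (s * p) p N z"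
proof -
  define P where "P k = qpoch (s * p * z) p (2 * k)" for k
  define R where "R k = qpoch (- (s * p / z)) p (2 * k)" for k
  define D where "D = prod_denom s p"
  \<comment> \<open>the telescoping sequence; \<open>u\<close> and \<open>v\<close> are the summands for the arguments \<open>p z\<close> and \<open>z / p\<close>\<close>
  define G where "G k = P k * R (Suc N - k) * (z ^ (Suc N - k) / z ^ k) / (D k * D (Suc N - k)) / p ^ Suc N" for k
  define u where "u k = qpoch (s * (p * z)) p (2 * k) * inverse (p * z) ^ k
      * (qpoch (- s * inverse (p * z)) p (2 * (Suc N - k)) * (p * z) ^ (Suc N - k)) / (D k * D (Suc N - k))" for k
  define v where "v k = qpoch (s * (z / p)) p (2 * k) * inverse (z / p) ^ k
      * (qpoch (- s * inverse (z / p)) p (2 * (Suc N - k)) * (z / p) ^ (Suc N - k)) / (D k * D (Suc N - k))" for k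
  define c where "c = - (1 - s ^ 4 * (p\<^sup>2) ^ Suc N) / (1 - s\<^sup>2 * p)\<^sup>2 / p ^ Suc N * (z - 1 / z)"
  have D0 [simp]: "D 0 = 1" by (simp add: D_def prod_denom_def)
  have P0: "P 0 = 1" "R 0 = 1" by (simp_all add: P_def R_def)
  have top: "u (Suc N) = G (Suc N)"
    by (simp add: u_def G_def P_def R_def power_mult_distrib field_simps ac_simps)
  have bot: "v 0 = G 0"
    using p z by (simp add: v_def G_def P_def R_def power_divide field_simps)
  have nz: "1 - a * (p ^ k)\<^sup>2 \<noteq> 0" if "norm a < 1" for a k
    using one_minus_mult_power_nonzero[OF that p(1), of "k * 2"] by (simp add: power_mult)
  have sp: "norm (s\<^sup>2 * p) < 1"
    by (intro norm_mult_less_one norm_square_less_one s p)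
  \<comment> \<open>the index of \<open>v\<close> is shifted so that both summands contain \<open>P k * R (N - k)\<close>\<close>
  have main: "u k - v (Suc k) + (G (Suc k) - G k)
      = c * (qpoch (s * p * z) p (2 * k) * inverse z ^ k
      * (qpoch (- (s * p) * inverse z) p (2 * (N - k)) * z ^ (N - k))
      / (prod_denom (s * p) p k * prod_denom (s * p) p (N - k)))" if "k \<le> N" for k
  proof -
    define l where "l = N - k"
    have l: "N - k = l" "Suc N - k = Suc l" "Suc N - Suc k = l"
      using that by (auto simp: l_def)
    have N: "N = k + l"
      using that by (simp add: l_def)
    define K where "K = p ^ k"
    define L where "L = p ^ l"
    have KL: "K \<noteq> 0" "L \<noteq> 0" using p by (auto simp: K_def L_def)
    have M: "p ^ Suc N = p * K * L" by (simp add: N K_def L_def power_add)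
    have dk: "D (Suc k) = D k * (1 - s\<^sup>2 * p * K\<^sup>2) * (1 - p\<^sup>2 * K\<^sup>2)"
      by (simp add: D_def K_def prod_denom_Suc)
    have dl: "D (Suc l) = D l * (1 - s\<^sup>2 * p * L\<^sup>2) * (1 - p\<^sup>2 * L\<^sup>2)"
      by (simp add: D_def L_def prod_denom_Suc)
    have Dnz: "D i \<noteq> 0" for i unfolding D_def by (rule prod_denom_nonzero[OF p(1) s])
    define F where "F = P k * R l * (z ^ l / z ^ k)"
    have uk: "u k = F * ((1 + s / (p * z)) * (1 + s / z) * z * p * L / K / (D k * D (Suc l)))"
    proof -
      have a1: "qpoch (- s * inverse (p * z)) p (2 * Suc l) = (1 + s / (p * z)) * (1 + s / z) * R l"
        using p(2) z unfolding qpoch_shift2 R_def by (simp add: field_simps)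
      have a2: "inverse (p * z) ^ k = 1 / (K * z ^ k)" and a3: "(p * z) ^ Suc l = p * L * (z * z ^ l)"
        by (simp_all add: K_def L_def power_mult_distrib field_simps)
      show ?thesis
        unfolding u_def l a1 a2 a3 F_def P_def by (simp add: ac_simps)
    qed
    have vk: "v (Suc k) = F * ((1 - s * z / p) * (1 - s * z) / z * (p * K / L) / (D (Suc k) * D l))"
    proof -
      have "qpoch (s * (z / p)) p (2 * Suc k) = (1 - s * z / p) * (1 - s * z) * P k"
        using p(2) z unfolding qpoch_shift2 P_def by (simp add: field_simps)
      moreover have "inverse (z / p) ^ Suc k = p * K / (z * z ^ k)" "(z / p) ^ l = z ^ l / L"
        using p(2) by (simp_all add: K_def L_def power_divide)
      moreover have "qpoch (- s * inverse (z / p)) p (2 * l) = R l"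
        using p(2) by (simp add: R_def)
      ultimately show ?thesis
        unfolding v_def l F_def P_def by (simp add: ac_simps)
    qed
    have Gk: "G k = F * ((1 + s * p * L\<^sup>2 / z) * (1 + s * p\<^sup>2 * L\<^sup>2 / z) * z / (D k * D (Suc l)) / (p * K * L))"
      unfolding G_def l M F_def R_def qpoch_Suc2 L_def[symmetric] by (simp add: ac_simps power2_eq_square)
    have GSk: "G (Suc k) = F * ((1 - s * z * p * K\<^sup>2) * (1 - s * z * p\<^sup>2 * K\<^sup>2) / z / (D (Suc k) * D l) / (p * K * L))"
      unfolding G_def l M F_def P_def qpoch_Suc2 K_def[symmetric] by (simp add: ac_simps power2_eq_square)
    have "u k - v (Suc k) + (G (Suc k) - G k)
      = F * (- (1 - s ^ 4 * p\<^sup>2 * K\<^sup>2 * L\<^sup>2) * (z - 1 / z) / (p * K * L)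
      / (D k * (1 - s\<^sup>2 * p * K\<^sup>2) * (D l * (1 - s\<^sup>2 * p * L\<^sup>2))))"
      unfolding uk vk Gk GSk dk dl
      unfolding right_diff_distrib[symmetric] distrib_left[symmetric] diff_divide_distrib[symmetric]
      by (subst prod_coeff_lowering_term)
         (use p z KL Dnz nz[OF sp] nz[OF norm_square_less_one[OF p(1)]] in \<open>auto simp: K_def L_def\<close>)
    also have "D k * (1 - s\<^sup>2 * p * K\<^sup>2) * (D l * (1 - s\<^sup>2 * p * L\<^sup>2))
      = prod_denom (s * p) p k * prod_denom (s * p) p l * (1 - s\<^sup>2 * p)\<^sup>2"
      unfolding D_def K_def L_def prod_denom_shift[symmetric] by (simp add: power2_eq_square ac_simps)
    also have "s ^ 4 * p\<^sup>2 * K\<^sup>2 * L\<^sup>2 = s ^ 4 * (p\<^sup>2) ^ Suc N"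
      by (simp add: N K_def L_def power_add power_mult_distrib flip: power_mult) (simp add: mult.commute)
    also have "F * (- (1 - s ^ 4 * (p\<^sup>2) ^ Suc N) * (z - 1 / z) / (p * K * L)
        / (prod_denom (s * p) p k * prod_denom (s * p) p l * (1 - s\<^sup>2 * p)\<^sup>2))
      = c * (P k * inverse z ^ k * (R l * z ^ l) / (prod_denom (s * p) p k * prod_denom (s * p) p l))"
    proof -
      have "P * R * (x / y) * (- U * W / M / (d * e * Y)) = - U / Y / M * W * (P * inverse y * (R * x) / (d * e))"
        for P R x y U W M d e Y :: complex
        by (simp add: divide_inverse ac_simps)
      then show ?thesis
        unfolding c_def M F_def power_inverse .
    qed
    finally show ?thesis
      unfolding l P_def R_def by (simp add: divide_inverse)
  qed
  have "prod_coeff s p (Suc N) (p * z) - prod_coeff s p (Suc N) (z / p) = (\<Sum>k\<le>Suc N. u k) - (\<Sum>k\<le>Suc N. v k)"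
    unfolding prod_coeff_def u_def v_def D_def ..
  also have "(\<Sum>k\<le>Suc N. u k) = (\<Sum>k\<le>N. u k) + G (Suc N)"
    by (simp add: top)
  also have "(\<Sum>k\<le>Suc N. v k) = G 0 + (\<Sum>k\<le>N. v (Suc k))"
    unfolding sum.atMost_Suc_shift bot ..
  also have "(\<Sum>k\<le>N. u k) + G (Suc N) - (G 0 + (\<Sum>k\<le>N. v (Suc k)))
      = (\<Sum>k\<le>N. u k - v (Suc k) + (G (Suc k) - G k))"
  proof -
    have "(\<Sum>k\<le>N. G (Suc k) - G k) = G (Suc N) - G 0"
      by (induction N) simp_all
    then show ?thesis by (simp add: sum.distrib sum_subtractf)
  qed
  also have "\<dots> = c * prod_coeff (s * p) p N z"
    unfolding prod_coeff_def sum_distrib_left by (intro sum.cong) (auto simp: main)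
  finally show ?thesis unfolding c_def .
qed

text \<open>The factor \<open>(-\<beta>, -\<beta> q\<^sup>1\<^sup>/\<^sup>2; q)\<^sub>n / (\<beta>\<^sup>2, \<beta> q\<^sup>1\<^sup>/\<^sup>2; q)\<^sub>n\<close> between the product coefficients and the Rogers
  polynomials.\<close>

definition prod_norm :: "complex \<Rightarrow> complex \<Rightarrow> nat \<Rightarrow> complex" where
  "prod_norm s p n = qpoch (- s\<^sup>2) p (2 * n) / (qpoch (s ^ 4) (p\<^sup>2) n * qpoch (s\<^sup>2 * p) (p\<^sup>2) n)"

lemma prod_norm_shift:
  assumes "norm p < 1" "norm s < 1"
  shows "prod_norm s p (Suc n) * (1 - s\<^sup>2)
    = (1 - s ^ 4 * (p\<^sup>2) ^ Suc n) / (1 - s\<^sup>2 * p)\<^sup>2 * prod_norm (s * p) p n"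
proof -
  note small = norm_square_less_one[OF assms(1)] norm_square_less_one[OF assms(2)]
  have s4: "s ^ 4 = s\<^sup>2 * s\<^sup>2" by (simp add: power2_eq_square power4_eq_xxxx)
  have small4: "norm (s ^ 4) < 1" unfolding s4 by (intro norm_mult_less_one small)
  define x where "x = qpoch (- s\<^sup>2 * p * p) p (2 * n)"
  define y where "y = qpoch (s ^ 4 * p\<^sup>2 * p\<^sup>2) (p\<^sup>2) n"
  define w where "w = qpoch (s\<^sup>2 * p * p\<^sup>2) (p\<^sup>2) n"
  have 1: "qpoch (- s\<^sup>2) p (2 * Suc n) = (1 + s\<^sup>2) * (1 + s\<^sup>2 * p) * x"
    unfolding qpoch_shift2 x_def by simp
  have 2: "qpoch (s ^ 4) (p\<^sup>2) (Suc n) * (1 - s ^ 4 * (p\<^sup>2) ^ Suc n) = (1 - s ^ 4) * (1 - s ^ 4 * p\<^sup>2) * y"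
  proof -
    have "qpoch (s ^ 4) (p\<^sup>2) (Suc n) * (1 - s ^ 4 * (p\<^sup>2) ^ Suc n) = qpoch (s ^ 4) (p\<^sup>2) (Suc (Suc n))"
      by (rule qpoch_Suc[symmetric])
    then show ?thesis unfolding y_def by (simp only: qpoch_shift mult.assoc)
  qed
  have 3: "qpoch (s\<^sup>2 * p) (p\<^sup>2) (Suc n) = (1 - s\<^sup>2 * p) * w"
    unfolding w_def by (rule qpoch_shift)
  have 4: "prod_norm (s * p) p n = x / (y * w)"
    unfolding prod_norm_def x_def y_def w_def
    by (simp add: power_mult_distrib power2_eq_square power4_eq_xxxx ac_simps)
  have nz: "y \<noteq> 0" "w \<noteq> 0" "1 - s\<^sup>2 * p \<noteq> 0" "qpoch (s ^ 4) (p\<^sup>2) (Suc n) \<noteq> 0"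
    "1 - s ^ 4 \<noteq> 0" "1 - s ^ 4 * p\<^sup>2 \<noteq> 0"
    unfolding y_def w_def
    by (intro qpoch_nonzero norm_mult_less_one one_minus_nonzero small small4 assms)+
  have 5: "(1 - s ^ 4 * (p\<^sup>2) ^ Suc n) = (1 - s ^ 4) * (1 - s ^ 4 * p\<^sup>2) * y / qpoch (s ^ 4) (p\<^sup>2) (Suc n)"
    using 2 nz(4) by (metis eq_divide_imp mult.commute)
  have "prod_norm s p (Suc n) * (1 - s\<^sup>2)
    = (1 + s\<^sup>2) * (1 + s\<^sup>2 * p) * x * (1 - s\<^sup>2) / (qpoch (s ^ 4) (p\<^sup>2) (Suc n) * ((1 - s\<^sup>2 * p) * w))"
    unfolding prod_norm_def 1 3 by simp
  also have "(1 + s\<^sup>2) * (1 + s\<^sup>2 * p) * x * (1 - s\<^sup>2) = (1 - s ^ 4) * (1 + s\<^sup>2 * p) * x"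
    by (simp add: algebra_simps power2_eq_square power4_eq_xxxx)
  also have "(1 - s ^ 4) * (1 + s\<^sup>2 * p) * x / (qpoch (s ^ 4) (p\<^sup>2) (Suc n) * ((1 - s\<^sup>2 * p) * w))
     = (1 - s ^ 4) * ((1 + s\<^sup>2 * p) * (1 - s\<^sup>2 * p)) * x / (qpoch (s ^ 4) (p\<^sup>2) (Suc n) * ((1 - s\<^sup>2 * p)\<^sup>2 * w))"
    using nz by (simp add: power2_eq_square)
  also have "(1 + s\<^sup>2 * p) * (1 - s\<^sup>2 * p) = 1 - s ^ 4 * p\<^sup>2"
    by (simp add: algebra_simps power2_eq_square power4_eq_xxxx)
  finally show ?thesis
    unfolding 4 5 using nz by simp
qed

lemma rogers_hom_inverse_lowering:
  assumes "norm p < 1" "p \<noteq> 0" "z \<noteq> 0"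
  shows "rogers_hom b (p\<^sup>2) (Suc n) (p * z) (1 / (p * z)) - rogers_hom b (p\<^sup>2) (Suc n) (z / p) (1 / (z / p))
    = - (1 - b) / p ^ Suc n * (z - 1 / z) * rogers_hom (p\<^sup>2 * b) (p\<^sup>2) n z (1 / z)"
proof -
  have 1: "p * z = 1 / p * (p\<^sup>2 * z)" "1 / (p * z) = 1 / p * (1 / z)" "z / p = 1 / p * z"
    "1 / (z / p) = 1 / p * (p\<^sup>2 * (1 / z))"
    using assms by (simp_all add: field_simps power2_eq_square)
  have "rogers_hom b (p\<^sup>2) (Suc n) (p * z) (1 / (p * z)) - rogers_hom b (p\<^sup>2) (Suc n) (z / p) (1 / (z / p))
    = rogers_hom b (p\<^sup>2) (Suc n) (1 / p * (p\<^sup>2 * z)) (1 / p * (1 / z))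
      - rogers_hom b (p\<^sup>2) (Suc n) (1 / p * z) (1 / p * (p\<^sup>2 * (1 / z)))"
    by (simp only: 1[symmetric])
  also have "\<dots> = (1 / p) ^ Suc n * (rogers_hom b (p\<^sup>2) (Suc n) (p\<^sup>2 * z) (1 / z)
      - rogers_hom b (p\<^sup>2) (Suc n) z (p\<^sup>2 * (1 / z)))"
    unfolding rogers_hom_scale by (simp only: right_diff_distrib)
  also have "\<dots> = - (1 - b) / p ^ Suc n * (z - 1 / z) * rogers_hom (p\<^sup>2 * b) (p\<^sup>2) n z (1 / z)"
    unfolding rogers_hom_lowering[OF norm_square_less_one[OF assms(1)]] power_one_over by simp
  finally show ?thesis .
qed

text \<open>The Laurent polynomials in question become polynomials after multiplication by a power of \<open>z\<close>, but their
  values at \<open>0\<close> are artefacts of division by zero and have to be excluded.\<close>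

definition polynomial_off_0 :: "(complex \<Rightarrow> complex) \<Rightarrow> bool" where
  "polynomial_off_0 f \<longleftrightarrow> (\<exists>Q. \<forall>z. z \<noteq> 0 \<longrightarrow> f z = poly Q z)"

lemma polynomial_off_0_const: "polynomial_off_0 (\<lambda>z. c)"
  unfolding polynomial_off_0_def by (rule exI[of _ "[:c:]"]) simp

lemma polynomial_off_0_id: "polynomial_off_0 (\<lambda>z. z)"
  unfolding polynomial_off_0_def by (rule exI[of _ "[:0, 1:]"]) simp

lemma polynomial_off_0_add: "polynomial_off_0 f \<Longrightarrow> polynomial_off_0 g \<Longrightarrow> polynomial_off_0 (\<lambda>z. f z + g z)"
proof -
  assume "polynomial_off_0 f" "polynomial_off_0 g"
  then obtain P Q where "\<And>z. z \<noteq> 0 \<Longrightarrow> f z = poly P z" "\<And>z. z \<noteq> 0 \<Longrightarrow> g z = poly Q z"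
    unfolding polynomial_off_0_def by blast
  then show ?thesis
    unfolding polynomial_off_0_def by (intro exI[of _ "P + Q"]) simp
qed

lemma polynomial_off_0_diff: "polynomial_off_0 f \<Longrightarrow> polynomial_off_0 g \<Longrightarrow> polynomial_off_0 (\<lambda>z. f z - g z)"
proof -
  assume "polynomial_off_0 f" "polynomial_off_0 g"
  then obtain P Q where "\<And>z. z \<noteq> 0 \<Longrightarrow> f z = poly P z" "\<And>z. z \<noteq> 0 \<Longrightarrow> g z = poly Q z"
    unfolding polynomial_off_0_def by blast
  then show ?thesis
    unfolding polynomial_off_0_def by (intro exI[of _ "P - Q"]) simp
qed

lemma polynomial_off_0_mult: "polynomial_off_0 f \<Longrightarrow> polynomial_off_0 g \<Longrightarrow> polynomial_off_0 (\<lambda>z. f z * g z)"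
proof -
  assume "polynomial_off_0 f" "polynomial_off_0 g"
  then obtain P Q where "\<And>z. z \<noteq> 0 \<Longrightarrow> f z = poly P z" "\<And>z. z \<noteq> 0 \<Longrightarrow> g z = poly Q z"
    unfolding polynomial_off_0_def by blast
  then show ?thesis
    unfolding polynomial_off_0_def by (intro exI[of _ "P * Q"]) simp
qed

lemma polynomial_off_0_power: "polynomial_off_0 f \<Longrightarrow> polynomial_off_0 (\<lambda>z. f z ^ n)"
  by (induction n) (auto intro: polynomial_off_0_const polynomial_off_0_mult)

lemma polynomial_off_0_sum: "finite A \<Longrightarrow> (\<And>k. k \<in> A \<Longrightarrow> polynomial_off_0 (f k)) \<Longrightarrow> polynomial_off_0 (\<lambda>z. \<Sum>k\<in>A. f k z)"
  by (induction rule: finite_induct) (auto intro: polynomial_off_0_const polynomial_off_0_add)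

lemma polynomial_off_0_prod: "finite A \<Longrightarrow> (\<And>k. k \<in> A \<Longrightarrow> polynomial_off_0 (f k)) \<Longrightarrow> polynomial_off_0 (\<lambda>z. \<Prod>k\<in>A. f k z)"
  by (induction rule: finite_induct) (auto intro: polynomial_off_0_const polynomial_off_0_mult)

lemma polynomial_off_0_cong: "(\<And>z. z \<noteq> 0 \<Longrightarrow> f z = g z) \<Longrightarrow> polynomial_off_0 f \<Longrightarrow> polynomial_off_0 g"
  unfolding polynomial_off_0_def by auto

lemma polynomial_off_0_prod_coeff: "polynomial_off_0 (\<lambda>z. z ^ n * prod_coeff s p n z)"
proof (rule polynomial_off_0_cong)
  fix z :: complex assume z: "z \<noteq> 0"
  show "(\<Sum>k\<le>n. (\<Prod>j<2 * k. 1 - s * z * p ^ j) * (\<Prod>j<2 * (n - k). z + s * p ^ j)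
      * (1 / (prod_denom s p k * prod_denom s p (n - k)))) = z ^ n * prod_coeff s p n z"
    unfolding prod_coeff_def sum_distrib_left
  proof (intro sum.cong refl)
    fix k assume "k \<in> {..n}"
    then have k: "z ^ n = z ^ k * z ^ (n - k)" by (simp flip: power_add)
    have "(\<Prod>j<2 * (n - k). z + s * p ^ j) = (\<Prod>j<2 * (n - k). z * (1 - (- s * inverse z) * p ^ j))"
      using z by (intro prod.cong) (auto simp: field_simps)
    also have "\<dots> = z ^ (n - k) * z ^ (n - k) * qpoch (- s * inverse z) p (2 * (n - k))"
      by (simp add: prod.distrib qpoch_def flip: power_add mult_2)
    finally show "(\<Prod>j<2 * k. 1 - s * z * p ^ j) * (\<Prod>j<2 * (n - k). z + s * p ^ j)
      * (1 / (prod_denom s p k * prod_denom s p (n - k)))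
      = z ^ n * (qpoch (s * z) p (2 * k) * inverse z ^ k
      * (qpoch (- s * inverse z) p (2 * (n - k)) * z ^ (n - k))
      / (prod_denom s p k * prod_denom s p (n - k)))"
      using z by (simp add: qpoch_def[of "s * z"] k power_inverse)
  qed
next
  show "polynomial_off_0 (\<lambda>z. \<Sum>k\<le>n. (\<Prod>j<2 * k. 1 - s * z * p ^ j) * (\<Prod>j<2 * (n - k). z + s * p ^ j)
      * (1 / (prod_denom s p k * prod_denom s p (n - k))))"
    by (intro polynomial_off_0_sum polynomial_off_0_mult polynomial_off_0_prod polynomial_off_0_add polynomial_off_0_diff
        polynomial_off_0_const polynomial_off_0_id) auto
qed

lemma polynomial_off_0_rogers_hom: "polynomial_off_0 (\<lambda>z. z ^ n * rogers_hom b q n z (1 / z))"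
proof (rule polynomial_off_0_cong)
  fix z :: complex assume z: "z \<noteq> 0"
  show "(\<Sum>k\<le>n. qbin b 1 q k * qbin b 1 q (n - k) * z ^ (n - k) * z ^ (n - k)) = z ^ n * rogers_hom b q n z (1 / z)"
    unfolding rogers_hom_def sum_distrib_left
  proof (intro sum.cong refl)
    fix k assume "k \<in> {..n}"
    then have k: "z ^ n = z ^ k * z ^ (n - k)" by (simp flip: power_add)
    show "qbin b 1 q k * qbin b 1 q (n - k) * z ^ (n - k) * z ^ (n - k)
      = z ^ n * (qbin b 1 q k * qbin b 1 q (n - k) * z ^ (n - k) * (1 / z) ^ k)"
      using z by (simp add: k power_one_over)
  qed
next
  show "polynomial_off_0 (\<lambda>z. \<Sum>k\<le>n. qbin b 1 q k * qbin b 1 q (n - k) * z ^ (n - k) * z ^ (n - k))"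
    by (intro polynomial_off_0_sum polynomial_off_0_mult polynomial_off_0_power polynomial_off_0_const polynomial_off_0_id) auto
qed

lemma polynomial_off_0_zero:
  assumes "polynomial_off_0 (\<lambda>z. z ^ n * f z)" "infinite {z. z \<noteq> 0 \<and> f z = 0}" "z \<noteq> 0"
  shows "f z = 0"
proof -
  obtain Q where Q: "\<And>z. z \<noteq> 0 \<Longrightarrow> z ^ n * f z = poly Q z"
    using assms(1) unfolding polynomial_off_0_def by auto
  have "{z. z \<noteq> 0 \<and> f z = 0} \<subseteq> {z. poly Q z = 0}"
    using Q by force
  then have "Q = 0"
    using assms(2) poly_roots_finite finite_subset by blast
  then show ?thesis using Q[OF assms(3)] assms(3) by simp
qed

text \<open>By induction on \<open>n\<close>, for all \<open>s\<close> at once since lowering changes \<open>\<beta>\<close> to \<open>q \<beta>\<close>. The difference \<open>E\<close> of both sides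
  is a Laurent polynomial with \<open>E (p z) = E (z / p)\<close> by the two lowering relations and the induction
  hypothesis. It vanishes at \<open>1 / s\<close>, where only one summand of the product coefficient survives; so it
  vanishes at all \<open>q\<^sup>j / s\<close> and is zero.\<close>

theorem prod_coeff_eq_rogers:
  assumes p: "norm p < 1" "p \<noteq> 0" and "norm s < 1" "s \<noteq> 0" and "z \<noteq> 0"
  shows "prod_coeff s p n z = prod_norm s p n * rogers_hom (s\<^sup>2) (p\<^sup>2) n z (1 / z)"
  using assms(3-)
proof (induction n arbitrary: s z)
  case 0
  then show ?case by (simp add: prod_coeff_def prod_norm_def prod_denom_def)
next
  case (Suc n)
  note s = Suc.prems(1,2)
  define E where "E z = prod_coeff s p (Suc n) z - prod_norm s p (Suc n) * rogers_hom (s\<^sup>2) (p\<^sup>2) (Suc n) z (1 / z)" for z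
  have sp: "norm (s * p) < 1" "s * p \<noteq> 0"
    using norm_mult_less_one[OF s(1) p(1)] s p by auto
  have shift: "E (p * z) = E (z / p)" if z: "z \<noteq> 0" for z
  proof -
    let ?R = "\<lambda>z. rogers_hom (s\<^sup>2) (p\<^sup>2) (Suc n) z (1 / z)"
    let ?r = "rogers_hom ((s * p)\<^sup>2) (p\<^sup>2) n z (1 / z)"
    let ?X = "1 / p ^ Suc n * (z - 1 / z)"
    let ?k = "(1 - s ^ 4 * (p\<^sup>2) ^ Suc n) / (1 - s\<^sup>2 * p)\<^sup>2"
    have "E (p * z) - E (z / p) = (prod_coeff s p (Suc n) (p * z) - prod_coeff s p (Suc n) (z / p))
      - prod_norm s p (Suc n) * (?R (p * z) - ?R (z / p))"
      unfolding E_def by (simp add: algebra_simps)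
    also have "prod_coeff s p (Suc n) (p * z) - prod_coeff s p (Suc n) (z / p)
      = - (?k * prod_norm (s * p) p n) * ?X * ?r"
    proof -
      have "- U / Y / M * W * (N * r) = - (U / Y * N) * (1 / M * W) * r" for U Y M W N r :: complex
        by simp
      then show ?thesis
        unfolding prod_coeff_lowering[OF p s(1) z] Suc.IH[OF sp z] .
    qed
    also have "?R (p * z) - ?R (z / p) = - (1 - s\<^sup>2) * ?X * ?r"
      unfolding rogers_hom_inverse_lowering[OF p z] by (simp add: power_mult_distrib mult.commute)
    also have "- (?k * prod_norm (s * p) p n) * ?X * ?r - prod_norm s p (Suc n) * (- (1 - s\<^sup>2) * ?X * ?r)
      = (prod_norm s p (Suc n) * (1 - s\<^sup>2) - ?k * prod_norm (s * p) p n) * (?X * ?r)"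
    proof -
      have "- (k * N) * X * r - M * (- S * X * r) = (M * S - k * N) * (X * r)" for k N X r M S :: complex
        by (simp add: algebra_simps)
      then show ?thesis .
    qed
    also have "\<dots> = 0"
      unfolding prod_norm_shift[OF p(1) s(1)] by simp
    finally show ?thesis by simp
  qed
  have base: "E (1 / s) = 0"
  proof -
    \<comment> \<open>all summands but the one for \<open>k = 0\<close> contain the factor \<open>1 - s z = 0\<close>\<close>
    have "qpoch 1 p (2 * Suc k) = 0" for k
      unfolding qpoch_shift2 by simp
    then have "prod_coeff s p (Suc n) (1 / s)
        = qpoch (- s\<^sup>2) p (2 * Suc n) * (1 / s) ^ Suc n / prod_denom s p (Suc n)"
      using s unfolding prod_coeff_def sum.atMost_Suc_shift
      by (simp add: prod_denom_def power2_eq_square del: mult_Suc_right power_Suc)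
    moreover have "rogers_hom (s\<^sup>2) (p\<^sup>2) (Suc n) (1 / s) (1 / (1 / s))
        = (1 / s) ^ Suc n * (qpoch ((s\<^sup>2)\<^sup>2) (p\<^sup>2) (Suc n) / qpoch (p\<^sup>2) (p\<^sup>2) (Suc n))"
      using rogers_hom_scale[of "s\<^sup>2" "p\<^sup>2" "Suc n" "1 / s" 1 "s\<^sup>2"] s
        rogers_hom_special_value[OF norm_square_less_one[OF p(1)], of "s\<^sup>2" "Suc n"]
      by (simp add: power2_eq_square)
    moreover have "qpoch ((s\<^sup>2)\<^sup>2) (p\<^sup>2) (Suc n) \<noteq> 0"
      by (intro qpoch_nonzero norm_square_less_one s p)
    ultimately show ?thesis
      by (simp add: E_def prod_norm_def prod_denom_def)
  qed
  have zeros: "E ((p\<^sup>2) ^ j / s) = 0" for j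
  proof (induction j)
    case (Suc j)
    have "E (p * (p * ((p\<^sup>2) ^ j / s))) = E ((p * ((p\<^sup>2) ^ j / s)) / p)"
      by (rule shift) (use p s in simp)
    then show ?case
      using Suc p by (simp add: power2_eq_square mult.assoc)
  qed (use base in simp)
  have "infinite {z. z \<noteq> 0 \<and> E z = 0}"
  proof -
    have "inj (\<lambda>j. (p\<^sup>2) ^ j / s)"
    proof (rule injI)
      fix i j assume "(p\<^sup>2) ^ i / s = (p\<^sup>2) ^ j / s"
      then have "norm (p\<^sup>2) ^ i = norm (p\<^sup>2) ^ j"
        using s by (simp flip: norm_power)
      then show "i = j"
        using norm_square_less_one[OF p(1)] p(2) by (intro power_inject_exp'[THEN iffD1])  simp_all
    qed
    then have "infinite (range (\<lambda>j. (p\<^sup>2) ^ j / s))"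
      by (rule range_inj_infinite)
    moreover have "range (\<lambda>j. (p\<^sup>2) ^ j / s) \<subseteq> {z. z \<noteq> 0 \<and> E z = 0}"
      using zeros p s by auto
    ultimately show ?thesis using infinite_super by blast
  qed
  moreover have "polynomial_off_0 (\<lambda>z. z ^ Suc n * E z)"
  proof (rule polynomial_off_0_cong)
    show "polynomial_off_0 (\<lambda>z. z ^ Suc n * prod_coeff s p (Suc n) z
      - prod_norm s p (Suc n) * (z ^ Suc n * rogers_hom (s\<^sup>2) (p\<^sup>2) (Suc n) z (1 / z)))"
      by (intro polynomial_off_0_diff polynomial_off_0_mult polynomial_off_0_const polynomial_off_0_prod_coeff polynomial_off_0_rogers_hom)
  qed (simp add: E_def algebra_simps)
  ultimately have "E z = 0"
    using polynomial_off_0_zero[of "Suc n" E z] Suc.prems(3) by blast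
  then show ?case by (simp add: E_def)
qed

section \<open>The q-binomial theorem\<close>

lemma qpoch_factors_summable:
  fixes a q :: complex
  assumes "norm q < 1"
  shows "summable (\<lambda>j. norm (a * q ^ j))"
  using assms by (simp add: norm_mult norm_power summable_mult summable_geometric)

lemma convergent_prod_qpoch:
  fixes a q :: complex
  assumes "norm q < 1"
  shows "convergent_prod (\<lambda>j. 1 - a * q ^ j)"
  by (intro abs_convergent_prod_imp_convergent_prod summable_imp_abs_convergent_prod)
     (use qpoch_factors_summable[OF assms, of a] in simp)

lemma qpoch_tendsto_qpoch_inf:
  assumes "norm q < 1"
  shows "(\<lambda>n. qpoch a q n) \<longlonglongrightarrow> qpoch_inf a q"
proof -
  have "(\<lambda>n. qpoch a q (Suc n)) \<longlonglongrightarrow> qpoch_inf a q"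
    using convergent_prod_LIMSEQ[OF convergent_prod_qpoch[OF assms, of a]]
    by (simp add: qpoch_def qpoch_inf_def lessThan_Suc_atMost)
  then show ?thesis by (rule LIMSEQ_imp_Suc)
qed

lemma qpoch_inf_nonzero:
  assumes "norm a < 1" "norm q < 1"
  shows "qpoch_inf a q \<noteq> 0"
  unfolding qpoch_inf_def
  by (rule prodinf_nonzero[OF convergent_prod_qpoch[OF assms(2)] one_minus_mult_power_nonzero[OF assms]])

lemma qpoch_inverse_bounded:
  assumes "norm a < 1" "norm q < 1"
  obtains C where "C > 0" "\<And>k. norm (1 / qpoch a q k) \<le> C"
proof -
  have "(\<lambda>n. 1 / qpoch a q n) \<longlonglongrightarrow> 1 / qpoch_inf a q"
    by (intro tendsto_intros qpoch_tendsto_qpoch_inf qpoch_inf_nonzero assms)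
  then have "Bseq (\<lambda>n. 1 / qpoch a q n)"
    by (metis Bseq_eq_bounded convergent_def convergent_imp_Bseq)
  then show ?thesis using that by (auto simp: Bseq_def)
qed

text \<open>The bound is uniform in \<open>b\<close>, which the interchange of limits below relies on.\<close>

lemma qprod_bound:
  fixes b c q :: complex
  assumes "norm q < 1" "norm b \<le> M" "c \<noteq> 0"
  shows "norm (\<Prod>j<k. c - b * q ^ j) \<le> exp (M / (norm c * (1 - norm q))) * norm c ^ k"
proof -
  have "norm (\<Prod>j<k. c - b * q ^ j) = (\<Prod>j<k. norm (c - b * q ^ j))"
    by (simp add: prod_norm)
  also have "\<dots> \<le> (\<Prod>j<k. norm c * exp (M / norm c * norm q ^ j))"
  proof (intro prod_mono conjI)
    fix j
    have "norm (c - b * q ^ j) \<le> norm c + M * norm q ^ j"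
      using norm_triangle_ineq4[of c "b * q ^ j"] mult_right_mono[OF assms(2), of "norm q ^ j"]
      by (simp add: norm_mult norm_power)
    also have "\<dots> = norm c * (1 + M / norm c * norm q ^ j)"
      using assms(3) by (simp add: field_simps)
    also have "\<dots> \<le> norm c * exp (M / norm c * norm q ^ j)"
      by (intro mult_left_mono exp_ge_add_one_self) auto
    finally show "norm (c - b * q ^ j) \<le> norm c * exp (M / norm c * norm q ^ j)" .
  qed auto
  also have "\<dots> = norm c ^ k * exp (M / norm c * (\<Sum>j<k. norm q ^ j))"
    by (simp add: prod.distrib exp_sum sum_distrib_left)
  also have "\<dots> \<le> norm c ^ k * exp (M / norm c * (1 / (1 - norm q)))"
  proof -
    have "(\<Sum>j<k. norm q ^ j) \<le> (\<Sum>j. norm q ^ j)"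
      by (intro sum_le_suminf) (use assms in auto)
    also have "\<dots> = 1 / (1 - norm q)"
      using assms by (simp add: suminf_geometric)
    finally have "(\<Sum>j<k. norm q ^ j) \<le> 1 / (1 - norm q)" .
    moreover have "M / norm c \<ge> 0"
      using order_trans[OF norm_ge_zero assms(2)] by simp
    ultimately have "M / norm c * (\<Sum>j<k. norm q ^ j) \<le> M / norm c * (1 / (1 - norm q))"
      by (rule mult_left_mono)
    then show ?thesis
      by (intro mult_left_mono) simp_all
  qed
  finally show ?thesis by (simp add: mult.commute)
qed

lemma qbin_bound:
  assumes "norm q < 1" "c \<noteq> 0"
  obtains C where "C > 0" "\<And>k. norm (qbin b c q k) \<le> C * norm c ^ k"
proof -
  obtain D where D: "D > 0" "\<And>k. norm (1 / qpoch q q k) \<le> D"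
    using qpoch_inverse_bounded[OF assms(1,1)] by blast
  define E where "E = exp (norm b / (norm c * (1 - norm q)))"
  have "norm (qbin b c q k) \<le> E * D * norm c ^ k" for k
  proof -
    have "norm (qbin b c q k) = norm (\<Prod>j<k. c - b * q ^ j) * norm (1 / qpoch q q k)"
      by (simp add: qbin_def norm_divide)
    also have "\<dots> \<le> (E * norm c ^ k) * D"
      unfolding E_def by (intro mult_mono qprod_bound D assms) auto
    finally show ?thesis by (simp add: ac_simps)
  qed
  moreover have "E * D > 0" using D by (simp add: E_def)
  ultimately show ?thesis using that by blast
qed

lemma qbin_summable_norm:
  assumes "norm q < 1" "c \<noteq> 0" "norm (c * u) < 1"
  shows "summable (\<lambda>k. norm (qbin b c q k * u ^ k))"
proof -
  obtain C where C: "\<And>k. norm (qbin b c q k) \<le> C * norm c ^ k"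
    using qbin_bound[OF assms(1,2)] by blast
  have "summable (\<lambda>k. C * norm (c * u) ^ k)"
    using assms(3) by (intro summable_mult summable_geometric) simp
  then show ?thesis
  proof (rule summable_comparison_test')
    fix k :: nat assume "0 \<le> k"
    show "norm (norm (qbin b c q k * u ^ k)) \<le> C * norm (c * u) ^ k"
      using mult_right_mono[OF C[of k], of "norm u ^ k"]
      by (simp add: norm_mult norm_power power_mult_distrib mult.assoc)
  qed
qed

text \<open>The sum \<open>F\<close> satisfies \<open>(1 - c u) F u = (1 - b u) F (q u)\<close>. Iteration moves the argument to \<open>0\<close>, where the
  power series is continuous with value \<open>1\<close>.\<close>

theorem q_binomial:
  assumes q: "norm q < 1" and c: "c \<noteq> 0" and u: "norm (c * u) < 1"
  shows "(\<lambda>k. qbin b c q k * u ^ k) sums (qpoch_inf (b * u) q / qpoch_inf (c * u) q)"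
proof -
  define F where "F v = (\<Sum>k. qbin b c q k * v ^ k)" for v
  have summ: "summable (\<lambda>k. qbin b c q k * v ^ k)" if "norm (c * v) < 1" for v
    using qbin_summable_norm[OF q c that] by (rule summable_norm_cancel)
  have step: "(1 - c * v) * F v = (1 - b * v) * F (q * v)" if v: "norm (c * v) < 1" for v
  proof -
    have qv: "norm (c * (q * v)) < 1"
      using norm_mult_less_one[OF v q] by (simp add: ac_simps)
    have split: "F x - a * F x = 1 + (\<Sum>k. (qbin b c q (Suc k) * x - a * qbin b c q k) * x ^ k)"
      if "norm (c * x) < 1" for x a
    proof -
      have "F x = 1 + (\<Sum>k. qbin b c q (Suc k) * x ^ Suc k)"
        unfolding F_def using suminf_split_head[OF summ[OF that]] by simp
      moreover have "a * F x = (\<Sum>k. a * (qbin b c q k * x ^ k))"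
        unfolding F_def using summ[OF that] by (rule suminf_mult[symmetric])
      moreover have "(\<Sum>k. qbin b c q (Suc k) * x ^ Suc k) - (\<Sum>k. a * (qbin b c q k * x ^ k))
        = (\<Sum>k. qbin b c q (Suc k) * x ^ Suc k - a * (qbin b c q k * x ^ k))"
      proof (rule suminf_diff)
        show "summable (\<lambda>k. qbin b c q (Suc k) * x ^ Suc k)"
          by (subst summable_Suc_iff[of "\<lambda>k. qbin b c q k * x ^ k"]) (rule summ[OF that])
        show "summable (\<lambda>k. a * (qbin b c q k * x ^ k))"
          by (intro summable_mult summ that)
      qed
      ultimately show ?thesis by (simp add: algebra_simps)
    qed
    have "(qbin b c q (Suc k) * v - c * v * qbin b c q k) * v ^ k
        = (qbin b c q (Suc k) * (q * v) - b * v * qbin b c q k) * (q * v) ^ k" for k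
    proof -
      have "qbin b c q (Suc k) - c * qbin b c q k = (qbin b c q (Suc k) * q - b * qbin b c q k) * q ^ k"
        using qbin_Suc[OF q, of b c k] by (simp add: algebra_simps)
      then have "(qbin b c q (Suc k) - c * qbin b c q k) * v * v ^ k
        = (qbin b c q (Suc k) * q - b * qbin b c q k) * q ^ k * v * v ^ k" by simp
      then show ?thesis by (simp add: algebra_simps power_mult_distrib)
    qed
    then have "F v - c * v * F v = F (q * v) - b * v * F (q * v)"
      unfolding split[OF v] split[OF qv] by simp
    then show ?thesis by (simp add: algebra_simps)
  qed
  have small: "norm (c * (q ^ n * u)) < 1" for n
    using norm_mult_power_less_one[OF u q, of n] by (simp add: ac_simps)
  have iter: "qpoch (c * u) q n * F u = qpoch (b * u) q n * F (q ^ n * u)" for n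
  proof (induction n)
    case (Suc n)
    have "qpoch (c * u) q (Suc n) * F u = (1 - c * (q ^ n * u)) * (qpoch (c * u) q n * F u)"
      by (simp add: qpoch_Suc ac_simps)
    also have "\<dots> = qpoch (b * u) q n * ((1 - c * (q ^ n * u)) * F (q ^ n * u))"
      unfolding Suc by (simp add: ac_simps)
    also have "\<dots> = qpoch (b * u) q (Suc n) * F (q ^ Suc n * u)"
      unfolding step[OF small] by (simp add: qpoch_Suc ac_simps)
    finally show ?case .
  qed simp
  have lim: "(\<lambda>n. F (q ^ n * u)) \<longlonglongrightarrow> 1"
  proof -
    \<comment> \<open>any nonzero point of the disc \<open>|c u| < 1\<close> shows continuity at \<open>0\<close>\<close>
    have K: "summable (\<lambda>k. qbin b c q k * (1 / (2 * c)) ^ k)"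
      by (rule summ) (use c in \<open>simp add: norm_mult norm_divide\<close>)
    have "isCont F 0"
      unfolding F_def using c by (intro isCont_powser[OF K]) simp
    moreover have "F 0 = 1" unfolding F_def by (simp add: powser_zero)
    moreover have "(\<lambda>n. q ^ n * u) \<longlonglongrightarrow> 0"
      using tendsto_mult[OF LIMSEQ_power_zero[OF q] tendsto_const[of u]] by simp
    ultimately show ?thesis
      using isCont_tendsto_compose[of 0 F "\<lambda>n. q ^ n * u" sequentially] by simp
  qed
  have "(\<lambda>n. qpoch (c * u) q n * F u) \<longlonglongrightarrow> qpoch_inf (c * u) q * F u"
    by (intro tendsto_intros qpoch_tendsto_qpoch_inf q)
  moreover have "(\<lambda>n. qpoch (c * u) q n * F u) \<longlonglongrightarrow> qpoch_inf (b * u) q * 1"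
    unfolding iter by (intro tendsto_intros qpoch_tendsto_qpoch_inf q lim)
  ultimately have "qpoch_inf (c * u) q * F u = qpoch_inf (b * u) q"
    using LIMSEQ_unique by fastforce
  then have "F u = qpoch_inf (b * u) q / qpoch_inf (c * u) q"
    using qpoch_inf_nonzero[OF u q] by (simp add: field_simps)
  then show ?thesis
    using summable_sums[OF summ[OF u]] by (simp add: F_def)
qed

section \<open>Moments of the weight\<close>

lemma sums_integral_uniform:
  fixes f :: "nat \<Rightarrow> real \<Rightarrow> complex"
  assumes cont: "\<And>k. continuous_on {a..b} (f k)"
    and bound: "\<And>k x. x \<in> {a..b} \<Longrightarrow> norm (f k x) \<le> M k" and M: "summable M"
  shows "continuous_on {a..b} (\<lambda>x. \<Sum>k. f k x)"
    and "(\<lambda>k. integral {a..b} (f k)) sums integral {a..b} (\<lambda>x. \<Sum>k. f k x)"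
proof -
  have lim: "uniform_limit {a..b} (\<lambda>n x. \<Sum>k<n. f k x) (\<lambda>x. \<Sum>k. f k x) sequentially"
    by (rule Weierstrass_m_test) (use bound M in auto)
  have c: "continuous_on {a..b} (\<lambda>x. \<Sum>k<n. f k x)" for n
    by (intro continuous_on_sum cont)
  show "continuous_on {a..b} (\<lambda>x. \<Sum>k. f k x)"
    by (rule uniform_limit_theorem[OF _ lim]) (use c in auto)
  obtain I J where I: "\<And>n. ((\<lambda>x. \<Sum>k<n. f k x) has_integral I n) {a..b}"
    and J: "((\<lambda>x. \<Sum>k. f k x) has_integral J) {a..b}" and IJ: "I \<longlonglongrightarrow> J"
    by (rule uniform_limit_integral[OF lim c]) auto
  have "I n = (\<Sum>k<n. integral {a..b} (f k))" for n
    using integral_unique[OF I[of n]]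
    by (simp add: integral_sum integrable_continuous_real cont)
  then have "I = (\<lambda>n. \<Sum>k<n. integral {a..b} (f k))" by auto
  then show "(\<lambda>k. integral {a..b} (f k)) sums integral {a..b} (\<lambda>x. \<Sum>k. f k x)"
    using IJ integral_unique[OF J] by (simp add: sums_def)
qed

lemma integral_cis_even:
  "integral {0..pi} (\<lambda>\<theta>. cis (2 * real_of_int r * \<theta>)) = (if r = 0 then complex_of_real pi else 0)"
proof (cases "r = 0")
  case False
  define F where "F \<theta> = cis (2 * real_of_int r * \<theta>) / (2 * of_int r * \<i>)" for \<theta>
  have "((\<lambda>\<theta>. cis (2 * real_of_int r * \<theta>)) has_integral (F pi - F 0)) {0..pi}"
  proof (rule fundamental_theorem_of_calculus)
    fix x :: real
    show "(F has_vector_derivative cis (2 * real_of_int r * x)) (at x within {0..pi})"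
      unfolding F_def has_vector_derivative_def using False
      by (auto intro!: derivative_eq_intros simp: field_simps scaleR_conv_of_real)
  qed simp
  moreover have "F pi = F 0"
  proof -
    have "cis (2 * real_of_int r * pi) = 1"
      using cis_multiple_2pi[of "real_of_int r"] by (simp add: ac_simps)
    then show ?thesis by (simp add: F_def)
  qed
  ultimately show ?thesis using False by (auto dest: integral_unique)
qed (simp add: scaleR_conv_of_real)

lemma integral_reflect_pi:
  fixes f :: "real \<Rightarrow> complex"
  assumes "continuous_on {0..pi} f"
  shows "integral {0..pi} (\<lambda>\<theta>. f (pi - \<theta>)) = integral {0..pi} f"
proof -
  have "(f has_integral integral {0..pi} f) (cbox 0 pi)"
    using assms by (simp add: integrable_integral integrable_continuous_real)
  from has_integral_affinity[OF this, of "-1" pi]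
  have "((\<lambda>x. f (pi - x)) has_integral integral {0..pi} f) ((\<lambda>x. pi - x) ` {0..pi})"
    by simp
  moreover have "(\<lambda>x. pi - x) ` {0..pi} = {0..pi}"
    by (auto simp: image_iff intro: bexI[of _ "pi - _"])
  ultimately show ?thesis by (auto dest: integral_unique)
qed

lemma qbin_difference:
  assumes "norm q < 1"
  shows "qbin 1 c q (Suc k) = qbin q c q (Suc k) - qbin q c q k"
proof -
  have nz: "1 - q ^ Suc k \<noteq> 0" by (rule one_minus_power_Suc_nonzero[OF assms])
  have "(\<Prod>j<Suc k. c - 1 * q ^ j) = (c - 1) * (\<Prod>j<k. c - q * q ^ j)"
    unfolding prod.lessThan_Suc_shift by simp
  then have "qbin 1 c q (Suc k) * (1 - q ^ Suc k) = (c - 1) * qbin q c q k"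
    using nz by (simp add: qbin_def qpoch_Suc)
  also have "\<dots> = (qbin q c q (Suc k) - qbin q c q k) * (1 - q ^ Suc k)"
    using qbin_Suc[OF assms, of q c k] by (simp add: algebra_simps)
  finally show ?thesis using nz by simp
qed

text \<open>The sums over \<open>k\<close> of the terms \<open>qbin 1 g q (k + j) * qbin q g q k\<close> are Laurent coefficients of
  \<open>(u, q / u; q)\<^sub>\<infinity> / (g u, g / u; q)\<^sub>\<infinity>\<close>. Here the common factor \<open>(g - 1) ... (g - q\<^sup>j\<^sup>-\<^sup>1)\<close> is removed, as it
  vanishes when \<open>g\<close> is a power of \<open>q\<close> and then would hide the value of the sum for \<open>j = 0\<close>.\<close>

definition reduced_term :: "complex \<Rightarrow> complex \<Rightarrow> nat \<Rightarrow> nat \<Rightarrow> complex" where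
  "reduced_term g q j k = (\<Prod>i<k. g - q ^ j * q ^ i) / qpoch q q (k + j) * qbin q g q k"

lemma reduced_term_0: "reduced_term g q 0 k = qbin 1 g q k * qbin q g q k"
  by (simp add: reduced_term_def qbin_def)

lemma reduced_term_eq:
  "(\<Prod>i<j. g - q ^ i) * reduced_term g q j k = qbin 1 g q (k + j) * qbin q g q k"
proof -
  have "(\<Prod>i<j + k. g - q ^ i) = (\<Prod>i<j. g - q ^ i) * (\<Prod>i<k. g - q ^ j * q ^ i)"
    by (induction k) (simp_all add: power_add mult.assoc)
  then show ?thesis by (simp add: reduced_term_def qbin_def add.commute)
qed

context
  fixes g q :: complex
  assumes g: "norm g < 1" "g \<noteq> 0" and q: "norm q < 1"
begin

lemma reduced_term_bound: "\<exists>C. \<forall>j k. norm (reduced_term g q j k) \<le> C * (norm g * norm g) ^ k"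
proof -
  obtain D where D: "D > 0" "\<And>k. norm (1 / qpoch q q k) \<le> D"
    using qpoch_inverse_bounded[OF q q] by blast
  obtain B where B: "B > 0" "\<And>k. norm (qbin q g q k) \<le> B * norm g ^ k"
    using qbin_bound[OF q g(2)] by blast
  define E where "E = exp (1 / (norm g * (1 - norm q)))"
  have "norm (reduced_term g q j k) \<le> E * D * B * (norm g * norm g) ^ k" for j k
  proof -
    have "norm (q ^ j) \<le> 1" using q by (simp add: norm_power power_le_one)
    then have "norm (\<Prod>i<k. g - q ^ j * q ^ i) \<le> E * norm g ^ k"
      unfolding E_def by (intro qprod_bound q g(2))
    then have "norm (\<Prod>i<k. g - q ^ j * q ^ i) * norm (1 / qpoch q q (k + j)) * norm (qbin q g q k)
      \<le> (E * norm g ^ k) * D * (B * norm g ^ k)"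
      using D B by (intro mult_mono) (auto simp: E_def)
    then show ?thesis
      by (simp add: reduced_term_def norm_mult norm_divide power_mult_distrib ac_simps)
  qed
  then show ?thesis by blast
qed

lemma norm_g_square: "norm g * norm g < 1"
  using norm_mult_less_one[OF g(1) g(1)] unfolding norm_mult .

lemma bound_summable: "summable (\<lambda>k. C * (norm g * norm g) ^ k)"
proof (rule summable_mult)
  show "summable (\<lambda>k. (norm g * norm g) ^ k)"
    by (rule summable_geometric) (use norm_g_square in \<open>simp only: real_norm_def abs_mult abs_norm_cancel\<close>)
qed

lemma reduced_term_summable: "summable (reduced_term g q j)"
proof -
  obtain C where C: "\<And>j k. norm (reduced_term g q j k) \<le> C * (norm g * norm g) ^ k"
    using reduced_term_bound by metis
  show ?thesis
  proof (rule summable_comparison_test'[OF bound_summable[of C], of 0])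
    fix k :: nat assume "0 \<le> k"
    show "norm (reduced_term g q j k) \<le> C * (norm g * norm g) ^ k"
      by (rule C)
  qed
qed

text \<open>A first-order recurrence in \<open>j\<close>: the difference of the summands is the difference of a sequence \<open>H\<close> that
  tends to \<open>0\<close>.\<close>

lemma reduced_term_suminf_step:
  "(\<Sum>k. reduced_term g q j k) = (1 - g * q ^ j) * (\<Sum>k. reduced_term g q (Suc j) k)"
proof -
  define H where "H k = (case k of 0 \<Rightarrow> 0 | Suc m \<Rightarrow> reduced_term g q (Suc j) m * (g - q ^ Suc m))" for k
  have tele: "(1 - g * q ^ j) * reduced_term g q (Suc j) k - reduced_term g q j k = q ^ j * (H k - H (Suc k))" for k
  proof (cases k)
    case 0
    have "1 - q ^ Suc j \<noteq> 0" by (rule one_minus_power_Suc_nonzero[OF q])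
    then have "1 / qpoch q q j = (1 - q ^ Suc j) / qpoch q q (Suc j)"
      by (simp add: qpoch_Suc)
    moreover have "(1 - g * q ^ j) / Q - (1 - q * q ^ j) / Q = - (q ^ j * (g - q) / Q)" for Q
    proof -
      have "(1 - g * q ^ j) - (1 - q * q ^ j) = - (q ^ j * (g - q))"
        by (simp add: algebra_simps)
      then show ?thesis
        by (simp only: diff_divide_distrib[symmetric] minus_divide_left[symmetric])
    qed
    ultimately show ?thesis
      unfolding 0 by (simp add: H_def reduced_term_def)
  next
    case (Suc m)
    \<comment> \<open>the common factor of the four terms for \<open>k = m + 1\<close>\<close>
    define X where "X = (\<Prod>i<m. g - q ^ Suc j * q ^ i) / qpoch q q (Suc m + j) * qbin q g q (Suc m)"
    have nz: "1 - q ^ Suc (Suc m + j) \<noteq> 0" by (rule one_minus_power_Suc_nonzero[OF q])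
    have T1: "reduced_term g q j (Suc m) = (g - q ^ j) * X"
      unfolding reduced_term_def X_def prod.lessThan_Suc_shift by (simp add: ac_simps)
    have T2: "reduced_term g q (Suc j) (Suc m) = X * (g - q ^ (Suc j + m)) / (1 - q ^ Suc (Suc m + j))"
      unfolding reduced_term_def X_def by (simp add: qpoch_Suc power_add ac_simps)
    have T3: "H (Suc m) = X * (1 - q ^ Suc m)"
    proof -
      have "qbin q g q m * (g - q ^ Suc m) = qbin q g q (Suc m) * (1 - q ^ Suc m)"
        using qbin_Suc[OF q, of q g m] by simp
      then have "H (Suc m) = (\<Prod>i<m. g - q ^ Suc j * q ^ i) / qpoch q q (Suc m + j) * (qbin q g q (Suc m) * (1 - q ^ Suc m))"
        unfolding H_def reduced_term_def by (simp add: mult.assoc)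
      then show ?thesis by (simp add: X_def)
    qed
    have T4: "H (Suc (Suc m)) = X * (g - q ^ (Suc j + m)) / (1 - q ^ Suc (Suc m + j)) * (g - q ^ Suc (Suc m))"
      unfolding H_def using T2 by simp
    define Q J where "Q = q ^ m" and "J = q ^ j"
    have P: "q ^ (Suc j + m) = q * J * Q" "q ^ Suc (Suc m + j) = q * q * J * Q" "q ^ Suc m = q * Q"
      "q ^ Suc (Suc m) = q * q * Q" "q ^ j = J"
      by (simp_all add: Q_def J_def power_add)
    have nz': "1 - q * q * J * Q \<noteq> 0" using nz unfolding P .
    have "(1 - g * J) * (X * (g - q * J * Q)) - (g - J) * X * (1 - q * q * J * Q)
      = J * (X * (1 - q * Q) * (1 - q * q * J * Q) - X * (g - q * J * Q) * (g - q * q * Q))"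
      by (simp add: algebra_simps)
    moreover have "(1 - g * J) * (Y / N) - Z = J * (U - Y / N * V)"
      if "(1 - g * J) * Y - Z * N = J * (U * N - Y * V)" "N \<noteq> 0" for N U V Y Z
      using that by (simp add: divide_simps)
    ultimately show ?thesis
      unfolding Suc T1 T2 T3 T4 P using nz' by blast
  qed
  have lim: "H \<longlonglongrightarrow> 0"
  proof -
    have "(\<lambda>m. reduced_term g q (Suc j) m * (g - q ^ Suc m)) \<longlonglongrightarrow> 0 * (g - 0)"
      by (intro tendsto_mult tendsto_diff tendsto_const summable_LIMSEQ_zero[OF reduced_term_summable]
          LIMSEQ_Suc[OF LIMSEQ_power_zero[OF q]])
    then show ?thesis
      by (intro LIMSEQ_imp_Suc[of H]) (simp add: H_def)
  qed
  have "(\<lambda>k. q ^ j * (H k - H (Suc k))) sums (q ^ j * (H 0 - 0))"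
    by (intro sums_mult telescope_sums' lim)
  then have "(\<lambda>k. (1 - g * q ^ j) * reduced_term g q (Suc j) k - reduced_term g q j k) sums 0"
    unfolding tele by (simp add: H_def)
  moreover have "(\<lambda>k. (1 - g * q ^ j) * reduced_term g q (Suc j) k - reduced_term g q j k) sums
    ((1 - g * q ^ j) * (\<Sum>k. reduced_term g q (Suc j) k) - (\<Sum>k. reduced_term g q j k))"
    by (intro sums_diff sums_mult summable_sums reduced_term_summable)
  ultimately show ?thesis using sums_unique2 by fastforce
qed

lemma reduced_term_suminf_iterate:
  "(\<Sum>k. reduced_term g q 0 k) = qpoch g q j * (\<Sum>k. reduced_term g q j k)"
proof (induction j)
  case (Suc j)
  then show ?case
    unfolding qpoch_Suc mult.assoc reduced_term_suminf_step[of j, symmetric] .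
qed simp

text \<open>A case of the \<open>q\<close>-Gauss summation. The recurrence pushes \<open>j\<close> to infinity, where dominated convergence
  replaces the sum by one which the \<open>q\<close>-binomial theorem evaluates.\<close>

theorem reduced_term_suminf_0:
  "(\<Sum>k. reduced_term g q 0 k)
    = qpoch_inf g q * qpoch_inf (q * g) q / (qpoch_inf (g\<^sup>2) q * qpoch_inf q q)"
proof -
  obtain C where C: "\<And>j k. norm (reduced_term g q j k) \<le> C * (norm g * norm g) ^ k"
    using reduced_term_bound by metis
  have "((\<lambda>j. \<Sum>k. reduced_term g q j k) \<longlonglongrightarrow> (\<Sum>k. g ^ k / qpoch_inf q q * qbin q g q k))"
  proof (rule tannerys_theorem[THEN conjunct2, THEN conjunct2])
    fix k
    have "(\<lambda>j. \<Prod>i<k. g - q ^ j * q ^ i) \<longlonglongrightarrow> (\<Prod>i<k. g - 0 * q ^ i)"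
      by (intro tendsto_intros LIMSEQ_power_zero q)
    moreover have "(\<lambda>j. qpoch q q (k + j)) \<longlonglongrightarrow> qpoch_inf q q"
      using LIMSEQ_ignore_initial_segment[OF qpoch_tendsto_qpoch_inf[OF q, of q], of k]
      by (simp add: add.commute)
    ultimately show "(\<lambda>j. reduced_term g q j k) \<longlonglongrightarrow> g ^ k / qpoch_inf q q * qbin q g q k"
      unfolding reduced_term_def using qpoch_inf_nonzero[OF q q]
      by (intro tendsto_intros) auto
  next
    show "\<forall>\<^sub>F (k, j) in at_top \<times>\<^sub>F sequentially. norm (reduced_term g q j k) \<le> C * (norm g * norm g) ^ k"
      using C by (intro always_eventually) auto
    show "summable (\<lambda>k. C * (norm g * norm g) ^ k)"
      by (rule bound_summable)
  qed simp
  then have lim: "(\<lambda>j. qpoch g q j * (\<Sum>k. reduced_term g q j k))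
      \<longlonglongrightarrow> qpoch_inf g q * (\<Sum>k. g ^ k / qpoch_inf q q * qbin q g q k)"
    by (intro tendsto_intros qpoch_tendsto_qpoch_inf q)
  have "(\<lambda>k. 1 / qpoch_inf q q * (qbin q g q k * g ^ k)) sums
      (1 / qpoch_inf q q * (qpoch_inf (q * g) q / qpoch_inf (g * g) q))"
    by (intro sums_mult q_binomial q g norm_mult_less_one)
  then have "(\<Sum>k. g ^ k / qpoch_inf q q * qbin q g q k)
      = 1 / qpoch_inf q q * (qpoch_inf (q * g) q / qpoch_inf (g * g) q)"
    by (simp add: sums_iff ac_simps)
  then show ?thesis
    using LIMSEQ_unique[OF tendsto_const lim[unfolded reduced_term_suminf_iterate[symmetric]]]
    by (simp add: power2_eq_square ac_simps)
qed

text \<open>The Laurent coefficients of \<open>(u, q / u; q)\<^sub>\<infinity> / (g u, g / u; q)\<^sub>\<infinity>\<close>. The weight itself has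
  \<open>1 / u\<close> in place of \<open>q / u\<close>; only after splitting off the factor \<open>1 - 1 / u\<close> do the coefficients satisfy a
  recurrence of first order.\<close>

definition half_moment :: "nat \<Rightarrow> complex" where
  "half_moment j = (\<Sum>k. qbin 1 g q (k + j) * qbin q g q k)"

lemma half_moment_eq: "half_moment j = (\<Prod>i<j. g - q ^ i) / qpoch g q j * half_moment 0"
proof -
  have "half_moment j = (\<Prod>i<j. g - q ^ i) * (\<Sum>k. reduced_term g q j k)" for j
    unfolding half_moment_def reduced_term_eq[symmetric]
    by (rule suminf_mult) (rule reduced_term_summable)
  from this[of j] this[of 0] show ?thesis
    using reduced_term_suminf_iterate[of j] qpoch_nonzero[OF g(1) q, of j] by simp
qed

lemma half_moment_summable: "summable (\<lambda>k. qbin 1 g q (k + j) * qbin q g q k)"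
  unfolding reduced_term_eq[symmetric] by (intro summable_mult reduced_term_summable)

lemma half_moment_0: "half_moment 0 = qpoch_inf g q * qpoch_inf (q * g) q / (qpoch_inf (g\<^sup>2) q * qpoch_inf q q)"
  unfolding half_moment_def reduced_term_suminf_0[symmetric] reduced_term_0 by simp

text \<open>The left-hand side is a Laurent coefficient of the weight; the difference on the right is the effect of
  the factor \<open>1 - 1 / u\<close>.\<close>

lemma half_moment_difference:
  "(\<lambda>k. qbin 1 g q k * qbin 1 g q (k + j)) sums (half_moment j - half_moment (Suc j))"
proof -
  let ?A = "qbin 1 g q" and ?B = "qbin q g q"
  have "(\<lambda>k. ?A (k + j) * ?B k) sums half_moment j" "(\<lambda>k. ?A (k + Suc j) * ?B k) sums half_moment (Suc j)"
    unfolding half_moment_def by (intro summable_sums half_moment_summable)+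
  from this(1) have "(\<lambda>k. ?A (Suc k + j) * ?B (Suc k)) sums (half_moment j - ?A j)"
    using sums_Suc_iff[of "\<lambda>k. ?A (k + j) * ?B k" "half_moment j - ?A j"] by simp
  from sums_diff[OF this \<open>(\<lambda>k. ?A (k + Suc j) * ?B k) sums half_moment (Suc j)\<close>]
  have "(\<lambda>k. ?A (Suc k) * ?A (Suc k + j)) sums (half_moment j - ?A j - half_moment (Suc j))"
    unfolding qbin_difference[OF q, of g] by (simp add: algebra_simps)
  then show ?thesis
    by (subst (asm) sums_Suc_iff) simp
qed

end

section \<open>Orthogonality and change of parameter\<close>

text \<open>For real parameters, the weight is the squared modulus of this function at \<open>u = e\<^sup>2\<^sup>i\<^sup>\<theta>\<close>.\<close>

definition density_factor :: "complex \<Rightarrow> complex \<Rightarrow> complex \<Rightarrow> complex" where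
  "density_factor g q u = qpoch_inf u q / qpoch_inf (g * u) q"

text \<open>The weight as a product, in a form that makes sense and is continuous for complex parameters.\<close>

definition rogers_density :: "complex \<Rightarrow> complex \<Rightarrow> real \<Rightarrow> complex" where
  "rogers_density g q \<theta> = density_factor g q (cis (2 * \<theta>)) * density_factor g q (cis (- 2 * \<theta>))"

abbreviation rogers_cis :: "complex \<Rightarrow> complex \<Rightarrow> nat \<Rightarrow> real \<Rightarrow> complex" where
  "rogers_cis b q n \<theta> \<equiv> rogers_hom b q n (cis \<theta>) (cis (- \<theta>))"

lemma continuous_on_cis_linear: "continuous_on A (\<lambda>\<theta>. cis (c * \<theta>))"
  by (intro continuous_intros)

lemma continuous_on_rogers_cis: "continuous_on A (rogers_cis b q n)"
  unfolding rogers_hom_def by (intro continuous_intros)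

lemma rogers_cis_reflect: "rogers_cis b q n (pi - \<theta>) = (- 1) ^ n * rogers_cis b q n \<theta>"
proof -
  have "cis (pi - \<theta>) = - 1 * cis (- \<theta>)" "cis (- (pi - \<theta>)) = - 1 * cis \<theta>"
    by (simp_all add: complex_eq_iff)
  then have "rogers_cis b q n (pi - \<theta>) = (- 1) ^ n * rogers_hom b q n (cis (- \<theta>)) (cis \<theta>)"
    by (simp only: rogers_hom_scale)
  then show ?thesis by (simp only: rogers_hom_commute[of b q n "cis \<theta>"])
qed

lemma density_reflect: "rogers_density g q (pi - \<theta>) = rogers_density g q \<theta>"
proof -
  have "cis (2 * (pi - \<theta>)) = cis (- 2 * \<theta>)" "cis (- 2 * (pi - \<theta>)) = cis (2 * \<theta>)"
    by (simp_all add: complex_eq_iff cos_diff sin_diff algebra_simps)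
  then show ?thesis by (simp add: rogers_density_def)
qed

text \<open>The recurrence for all indices at once, without a polynomial of index \<open>-1\<close>.\<close>

lemma rogers_cis_recurrence:
  assumes "norm q < 1"
  shows "(1 - q ^ Suc m) * rogers_cis b q (Suc m) \<theta>
      + (if m = 0 then 0 else (1 - b\<^sup>2 * q ^ (m - 1)) * rogers_cis b q (m - 1) \<theta>)
    = (1 - b * q ^ m) * ((cis \<theta> + cis (- \<theta>)) * rogers_cis b q m \<theta>)"
proof (cases m)
  case 0
  then show ?thesis using rogers_hom_1[OF assms] by simp
next
  case (Suc k)
  have "cis \<theta> * cis (- \<theta>) = 1" by (simp add: cis_mult)
  then show ?thesis
    unfolding Suc using rogers_hom_recurrence[OF assms, of k b "cis \<theta>" "cis (- \<theta>)"]
    by simp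
qed

lemma rogers_hom_chebyshev:
  assumes "norm q < 1"
  shows "rogers_hom q q n z w = (\<Sum>k\<le>n. z ^ (n - k) * w ^ k)"
  using qpoch_nonzero[OF assms assms] by (simp add: rogers_hom_def qbin_one)

lemma rogers_cis_chebyshev_step:
  assumes "norm q < 1"
  shows "rogers_cis q q (Suc (Suc n)) \<theta>
    = rogers_cis q q n \<theta> + cis (real (Suc (Suc n)) * \<theta>) + cis (- (real (Suc (Suc n)) * \<theta>))"
proof -
  let ?z = "cis \<theta>" and ?w = "cis (- \<theta>)"
  have zw: "?z * ?w = 1" by (simp add: cis_mult)
  have "(\<Sum>k\<le>Suc (Suc n). ?z ^ (Suc (Suc n) - k) * ?w ^ k)
    = ?z ^ Suc (Suc n) + (\<Sum>k\<le>n. ?z ^ (Suc n - k) * ?w ^ Suc k) + ?w ^ Suc (Suc n)"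
    unfolding sum.atMost_Suc_shift[of _ "Suc n"] by simp
  also have "(\<Sum>k\<le>n. ?z ^ (Suc n - k) * ?w ^ Suc k) = (\<Sum>k\<le>n. ?z ^ (n - k) * ?w ^ k)"
  proof (intro sum.cong refl)
    fix k assume "k \<in> {..n}"
    then have "?z ^ (Suc n - k) * ?w ^ Suc k = (?z * ?w) * (?z ^ (n - k) * ?w ^ k)"
      by (simp add: Suc_diff_le)
    then show "?z ^ (Suc n - k) * ?w ^ Suc k = ?z ^ (n - k) * ?w ^ k"
      unfolding zw by simp
  qed
  finally show ?thesis
    unfolding rogers_hom_chebyshev[OF assms] unfolding Complex.DeMoivre mult_minus_right
    by (simp del: sum.atMost_Suc power_Suc of_nat_Suc add: ac_simps)
qed

text \<open>Let \<open>T m n\<close> be the value of a linear functional on the product of the \<open>m\<close>-th polynomial for \<open>b\<close> and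
  the \<open>n\<close>-th one for \<open>g\<close>. The value on this product times \<open>z + w\<close> can be expanded by either of the two
  three-term recurrences; the equation of both expansions is the relation below. It determines \<open>T\<close> from
  its first column and also from its first row.\<close>

definition mixed_recurrence :: "complex \<Rightarrow> complex \<Rightarrow> complex \<Rightarrow> (nat \<Rightarrow> nat \<Rightarrow> complex) \<Rightarrow> bool" where
  "mixed_recurrence b g q T \<longleftrightarrow> (\<forall>m n.
    ((1 - q ^ Suc m) * T (Suc m) n + (if m = 0 then 0 else (1 - b\<^sup>2 * q ^ (m - 1)) * T (m - 1) n)) * (1 - g * q ^ n)
    = ((1 - q ^ Suc n) * T m (Suc n) + (if n = 0 then 0 else (1 - g\<^sup>2 * q ^ (n - 1)) * T m (n - 1))) * (1 - b * q ^ m))"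

lemma mixed_recurrence_transpose: "mixed_recurrence b g q T \<Longrightarrow> mixed_recurrence g b q (\<lambda>m n. T n m)"
  unfolding mixed_recurrence_def by (simp only: eq_commute) blast

lemma mixed_recurrence_unique_column:
  assumes q: "norm q < 1" and b: "norm b < 1"
    and T: "mixed_recurrence b g q T" and U: "mixed_recurrence b g q U" and col: "\<And>m. T m 0 = U m 0"
  shows "T m n = U m n"
proof (induction n arbitrary: m rule: less_induct)
  case (less n)
  show ?case
  proof (cases n)
    case 0
    then show ?thesis by (simp add: col)
  next
    case (Suc k)
    have *: "T i k = U i k" "T i (k - 1) = U i (k - 1)" for i
      using less[of k] less[of "k - 1"] Suc by auto
    have "((1 - q ^ Suc k) * T m (Suc k) + (if k = 0 then 0 else (1 - g\<^sup>2 * q ^ (k - 1)) * T m (k - 1))) * (1 - b * q ^ m)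
      = ((1 - q ^ Suc k) * U m (Suc k) + (if k = 0 then 0 else (1 - g\<^sup>2 * q ^ (k - 1)) * U m (k - 1))) * (1 - b * q ^ m)"
      using T U unfolding mixed_recurrence_def by (metis *(1))
    then show ?thesis
      unfolding Suc *(2)
      using one_minus_mult_power_nonzero[OF b q, of m] one_minus_power_Suc_nonzero[OF q, of k]
      by simp
  qed
qed

lemma mixed_recurrence_unique_row:
  assumes "norm q < 1" "norm g < 1" "mixed_recurrence b g q T" "mixed_recurrence b g q U" "\<And>n. T 0 n = U 0 n"
  shows "T m n = U m n"
  by (rule mixed_recurrence_unique_column[OF assms(1,2) mixed_recurrence_transpose[OF assms(3)] mixed_recurrence_transpose[OF assms(4)]])
     (rule assms(5))

text \<open>The value of the mixed moment of indices \<open>n + 2 k\<close> and \<open>n\<close>, up to a constant factor: the connection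
  coefficient of Rogers times the squared norm of the \<open>n\<close>-th polynomial for \<open>g\<close>.\<close>

definition closed_form_step :: "complex \<Rightarrow> complex \<Rightarrow> complex \<Rightarrow> nat \<Rightarrow> nat \<Rightarrow> complex" where
  "closed_form_step b g q n k = qpoch (g\<^sup>2) q n / qpoch q q n * (\<Prod>j<k. g - b * q ^ j) * qpoch b q (n + k)
    / (qpoch q q k * qpoch g q (Suc (n + k)))"

definition closed_form :: "complex \<Rightarrow> complex \<Rightarrow> complex \<Rightarrow> nat \<Rightarrow> nat \<Rightarrow> complex" where
  "closed_form b g q m n = (if n \<le> m \<and> even (m - n) then closed_form_step b g q n ((m - n) div 2) else 0)"

lemma closed_form_add: "closed_form b g q (n + 2 * k) n = closed_form_step b g q n k"
  by (simp add: closed_form_def)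

text \<open>All terms vanish unless \<open>m + 1 = n + 2 j\<close> for some \<open>j\<close>. If \<open>j = 0\<close>, two of the four terms remain. Otherwise
  all four are rational multiples of the same quantity \<open>X\<close>, and an identity of polynomials in
  \<open>b\<close>, \<open>g\<close>, \<open>q\<close>, \<open>q\<^sup>n\<close>, \<open>q\<^sup>k\<close> remains.\<close>

lemma mixed_recurrence_closed_form:
  assumes b: "norm b < 1" and g: "norm g < 1" and q: "norm q < 1"
  shows "mixed_recurrence b g q (closed_form b g q)"
  unfolding mixed_recurrence_def
proof (intro allI)
  fix m n
  let ?E = "closed_form b g q"
  note nz = one_minus_mult_power_nonzero[OF b q] one_minus_mult_power_nonzero[OF g q]
    one_minus_power_Suc_nonzero[OF q] qpoch_nonzero[OF q q] qpoch_nonzero[OF g q]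
    one_minus_mult_power_nonzero[OF norm_square_less_one[OF g] q]
  show "((1 - q ^ Suc m) * ?E (Suc m) n + (if m = 0 then 0 else (1 - b\<^sup>2 * q ^ (m - 1)) * ?E (m - 1) n)) * (1 - g * q ^ n)
    = ((1 - q ^ Suc n) * ?E m (Suc n) + (if n = 0 then 0 else (1 - g\<^sup>2 * q ^ (n - 1)) * ?E m (n - 1))) * (1 - b * q ^ m)"
  proof (cases "n \<le> Suc m \<and> even (Suc m - n)")
    case False
    then consider "Suc m < n" | "n \<le> Suc m" "odd (Suc m - n)" by force
    then have "?E (Suc m) n = 0 \<and> ?E m (Suc n) = 0 \<and> (m \<noteq> 0 \<longrightarrow> ?E (m - 1) n = 0)
      \<and> (n \<noteq> 0 \<longrightarrow> ?E m (n - 1) = 0)"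
    proof cases
      case 1
      then show ?thesis by (auto simp: closed_form_def)
    next
      case 2
      then obtain i where "Suc m - n = 2 * i + 1" by (elim oddE)
      then have m: "m = n + 2 * i" using 2(1) by simp
      show ?thesis
      proof (cases i)
        case 0
        then show ?thesis by (cases n) (simp_all add: closed_form_def m)
      next
        case (Suc i')
        then show ?thesis by (cases n) (simp_all add: closed_form_def m)
      qed
    qed
    then show ?thesis by (cases "m = 0"; cases "n = 0") simp_all
  next
    case True
    then obtain j where j: "Suc m = n + 2 * j" by (metis add_diff_inverse_nat dvdE not_le)
    show ?thesis
    proof (cases j)
      case 0
      then have n: "n = Suc m" using j by simp
      have z: "?E m (Suc (Suc m)) = 0" "m \<noteq> 0 \<Longrightarrow> ?E (m - 1) (Suc m) = 0"
        by (auto simp: closed_form_def)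
      have e: "?E (Suc m) (Suc m) = closed_form_step b g q (Suc m) 0" "?E m m = closed_form_step b g q m 0"
        using closed_form_add[of b g q _ 0] by auto
      have "closed_form_step b g q (Suc m) 0 * (1 - q ^ Suc m) * (1 - g * q ^ Suc m)
        = closed_form_step b g q m 0 * (1 - g\<^sup>2 * q ^ m) * (1 - b * q ^ m)"
        unfolding closed_form_step_def using nz(2)[of "Suc m"] nz(3)[of m]
        by (simp add: qpoch_Suc)
      then show ?thesis
        unfolding n using z e by (cases "m = 0") (simp_all add: ac_simps)
    next
      case (Suc k)
      then have m: "m = Suc (n + 2 * k)" using j by simp
      define X where "X = closed_form_step b g q n k"
      define D where "D = (1 - q ^ Suc k) * (1 - g * q ^ Suc (n + k))"
      have D: "D \<noteq> 0" using nz by (simp add: D_def del: power_Suc)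
      have 1: "?E (Suc m) n * D = X * ((g - b * q ^ k) * (1 - b * q ^ (n + k)))"
      proof -
        have "?E (Suc m) n = closed_form_step b g q n (Suc k)"
          using closed_form_add[of b g q n "Suc k"] by (simp add: m)
        then show ?thesis
          unfolding X_def D_def closed_form_step_def using nz(2)[of "Suc (n + k)"] nz(3)[of k]
          by (simp add: qpoch_Suc[of _ _ "n + k"] qpoch_Suc[of _ _ k] qpoch_Suc[of _ _ "Suc (n + k)"])
      qed
      have 2: "?E (m - 1) n = X"
        by (simp add: m closed_form_add X_def)
      have 3: "(1 - q ^ Suc n) * ?E m (Suc n) * D = X * ((1 - g\<^sup>2 * q ^ n) * (1 - b * q ^ (n + k)) * (1 - q ^ Suc k))"
      proof -
        have "?E m (Suc n) = closed_form_step b g q (Suc n) k"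
          using closed_form_add[of b g q "Suc n" k] by (simp add: m)
        then show ?thesis
          unfolding X_def D_def closed_form_step_def using nz(2)[of "Suc (n + k)"] nz(3)[of n]
          by (simp add: qpoch_Suc[of _ _ "n + k"] qpoch_Suc[of _ _ n] qpoch_Suc[of _ _ "Suc (n + k)"])
      qed
      have 4: "(if n = 0 then 0 else (1 - g\<^sup>2 * q ^ (n - 1)) * ?E m (n - 1)) * D
        = X * ((1 - q ^ n) * (g - b * q ^ k) * (1 - g * q ^ Suc (n + k)))"
      proof (cases n)
        case (Suc i)
        have "?E m (n - 1) = closed_form_step b g q i (Suc k)"
          using closed_form_add[of b g q i "Suc k"] by (simp add: m Suc)
        then show ?thesis
          unfolding X_def D_def closed_form_step_def Suc using nz(6)[of i] nz(3)[of i] nz(3)[of k]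
          by (simp add: qpoch_Suc[of _ _ i] qpoch_Suc[of _ _ k])
      qed simp
      define N K where "N = q ^ n" and "K = q ^ k"
      have P: "q ^ Suc m = q * q * N * K * K" "q ^ (m - 1) = N * K * K" "q ^ m = q * N * K * K"
        "q ^ n = N" "q ^ k = K" "q ^ Suc k = q * K" "q ^ (n + k) = N * K" "q ^ Suc (n + k) = q * N * K"
        by (simp_all add: m N_def K_def power_add power_mult power2_eq_square power_mult_distrib)
      have "((1 - q ^ Suc m) * ?E (Suc m) n + (if m = 0 then 0 else (1 - b\<^sup>2 * q ^ (m - 1)) * ?E (m - 1) n)) * (1 - g * q ^ n) * D
        = ((1 - q ^ Suc m) * (?E (Suc m) n * D) + (1 - b\<^sup>2 * q ^ (m - 1)) * X * D) * (1 - g * q ^ n)"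
        unfolding 2 by (simp add: m algebra_simps)
      also have "\<dots> = X * (((1 - q ^ Suc m) * ((g - b * q ^ k) * (1 - b * q ^ (n + k))) + (1 - b\<^sup>2 * q ^ (m - 1)) * D) * (1 - g * q ^ n))"
        unfolding 1 by (simp only: distrib_left distrib_right ac_simps)
      also have "((1 - q ^ Suc m) * ((g - b * q ^ k) * (1 - b * q ^ (n + k))) + (1 - b\<^sup>2 * q ^ (m - 1)) * D) * (1 - g * q ^ n)
        = ((1 - g\<^sup>2 * q ^ n) * (1 - b * q ^ (n + k)) * (1 - q ^ Suc k)
            + (1 - q ^ n) * (g - b * q ^ k) * (1 - g * q ^ Suc (n + k))) * (1 - b * q ^ m)"
        unfolding D_def P by (simp add: algebra_simps power2_eq_square)
      also have "X * \<dots> = ((1 - q ^ Suc n) * ?E m (Suc n) * D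
          + (if n = 0 then 0 else (1 - g\<^sup>2 * q ^ (n - 1)) * ?E m (n - 1)) * D) * (1 - b * q ^ m)"
        unfolding 3 4 by (simp only: distrib_left ac_simps)
      also have "\<dots> = ((1 - q ^ Suc n) * ?E m (Suc n)
          + (if n = 0 then 0 else (1 - g\<^sup>2 * q ^ (n - 1)) * ?E m (n - 1))) * (1 - b * q ^ m) * D"
      proof -
        have "(x * D + y * D) * z = (x + y) * z * D" for x y z
          by (simp add: algebra_simps)
        then show ?thesis .
      qed
      finally show ?thesis using D by simp
    qed
  qed
qed

context
  fixes g q :: complex
  assumes g: "norm g < 1" "g \<noteq> 0" and q: "norm q < 1"
begin

lemma qbin_norm_summable: "summable (\<lambda>k. norm (qbin 1 g q k))"
  using qbin_summable_norm[OF q g(2), of 1] g(1) by simp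

lemma density_factor_sums:
  assumes "norm u = 1"
  shows "(\<lambda>k. qbin 1 g q k * u ^ k) sums density_factor g q u"
  using q_binomial[OF q g(2), of u 1] g(1) assms by (simp add: density_factor_def norm_mult)

lemma density_factor_cis: "density_factor g q (cis \<theta>) = (\<Sum>k. qbin 1 g q k * cis (real k * \<theta>))"
  using sums_unique[OF density_factor_sums[of "cis \<theta>"]] by (simp add: Complex.DeMoivre)

lemma continuous_on_density_factor: "continuous_on {0..pi} (\<lambda>\<theta>. density_factor g q (cis (c * \<theta>)))"
proof -
  have "continuous_on {0..pi} (\<lambda>\<theta>. \<Sum>k. qbin 1 g q k * cis (real k * (c * \<theta>)))"
    by (rule sums_integral_uniform(1)[where M = "\<lambda>k. norm (qbin 1 g q k)"])
       (auto intro!: continuous_intros qbin_norm_summable simp: norm_mult)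
  then show ?thesis by (simp only: density_factor_cis)
qed

lemma continuous_on_density: "continuous_on {0..pi} (rogers_density g q)"
  unfolding rogers_density_def by (intro continuous_on_mult continuous_on_density_factor)

lemma norm_density_factor_bound: "norm (density_factor g q (cis \<theta>)) \<le> (\<Sum>k. norm (qbin 1 g q k))"
proof -
  have "summable (\<lambda>k. norm (qbin 1 g q k * cis (real k * \<theta>)))"
    using qbin_norm_summable by (simp add: norm_mult)
  from summable_norm[OF this] show ?thesis
    unfolding density_factor_cis by (simp add: norm_mult)
qed

lemma integral_cis_density_factor:
  "integral {0..pi} (\<lambda>\<theta>. cis (2 * real s * \<theta>) * density_factor g q (cis (- 2 * \<theta>))) = pi * qbin 1 g q s"
proof -
  define f where "f k \<theta> = qbin 1 g q k * cis (2 * real_of_int (int s - int k) * \<theta>)" for k \<theta>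
  have eq: "cis (2 * real s * \<theta>) * density_factor g q (cis (- 2 * \<theta>)) = (\<Sum>k. f k \<theta>)" for \<theta>
  proof -
    have "(\<lambda>k. cis (2 * real s * \<theta>) * (qbin 1 g q k * cis (- 2 * \<theta>) ^ k)) sums
        (cis (2 * real s * \<theta>) * density_factor g q (cis (- 2 * \<theta>)))"
      by (intro sums_mult density_factor_sums) simp
    moreover have "cis (2 * real s * \<theta>) * (qbin 1 g q k * cis (- 2 * \<theta>) ^ k) = f k \<theta>" for k
    proof -
      have "cis (2 * real s * \<theta>) * cis (- 2 * \<theta>) ^ k = cis (2 * real_of_int (int s - int k) * \<theta>)"
        unfolding Complex.DeMoivre cis_mult by (rule arg_cong[of _ _ cis]) (simp add: algebra_simps)
      then show ?thesis by (simp add: f_def ac_simps)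
    qed
    ultimately show ?thesis by (simp add: sums_iff)
  qed
  have "(\<lambda>k. integral {0..pi} (f k)) sums integral {0..pi} (\<lambda>\<theta>. \<Sum>k. f k \<theta>)"
    unfolding f_def
    by (rule sums_integral_uniform(2)[where M = "\<lambda>k. norm (qbin 1 g q k)"])
       (auto intro!: continuous_intros qbin_norm_summable simp: norm_mult)
  moreover have "integral {0..pi} (f k) = (if k = s then pi * qbin 1 g q s else 0)" for k
    unfolding f_def integral_mult_right integral_cis_even by auto
  ultimately have "(\<lambda>k. if k = s then pi * qbin 1 g q s else 0) sums integral {0..pi} (\<lambda>\<theta>. \<Sum>k. f k \<theta>)"
    by simp
  then show ?thesis
    unfolding eq using sums_single[of s "\<lambda>_. pi * qbin 1 g q s"] sums_unique2 by blast
qed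

text \<open>Expand both factors of the density by the \<open>q\<close>-binomial theorem and integrate termwise; the even
  exponentials are orthogonal on the half period \<open>[0, \<pi>]\<close>.\<close>

lemma density_moment:
  "integral {0..pi} (\<lambda>\<theta>. cis (2 * real m * \<theta>) * rogers_density g q \<theta>) = pi * (half_moment g q m - half_moment g q (Suc m))"
proof -
  define B where "B = (\<Sum>k. norm (qbin 1 g q k))"
  define f where "f k \<theta> = qbin 1 g q k * (cis (2 * real (k + m) * \<theta>) * density_factor g q (cis (- 2 * \<theta>)))" for k \<theta>
  have eq: "cis (2 * real m * \<theta>) * rogers_density g q \<theta> = (\<Sum>k. f k \<theta>)" for \<theta>
  proof -
    have "(\<lambda>k. cis (2 * real m * \<theta>) * (qbin 1 g q k * cis (2 * \<theta>) ^ k) * density_factor g q (cis (- 2 * \<theta>))) sums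
        (cis (2 * real m * \<theta>) * density_factor g q (cis (2 * \<theta>)) * density_factor g q (cis (- 2 * \<theta>)))"
      by (intro sums_mult sums_mult2 density_factor_sums) simp
    moreover have "cis (2 * real m * \<theta>) * (qbin 1 g q k * cis (2 * \<theta>) ^ k) * density_factor g q (cis (- 2 * \<theta>)) = f k \<theta>" for k
    proof -
      have "cis (2 * real m * \<theta>) * cis (2 * \<theta>) ^ k = cis (2 * real (k + m) * \<theta>)"
        unfolding Complex.DeMoivre cis_mult by (rule arg_cong[of _ _ cis]) (simp add: algebra_simps)
      then show ?thesis by (simp add: f_def ac_simps)
    qed
    ultimately show ?thesis by (simp add: sums_iff rogers_density_def mult.assoc)
  qed
  have "(\<lambda>k. integral {0..pi} (f k)) sums integral {0..pi} (\<lambda>\<theta>. \<Sum>k. f k \<theta>)"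
  proof (rule sums_integral_uniform(2)[where M = "\<lambda>k. norm (qbin 1 g q k) * B"])
    show "continuous_on {0..pi} (f k)" for k
      unfolding f_def by (intro continuous_on_mult continuous_on_const continuous_on_cis_linear continuous_on_density_factor)
    show "norm (f k \<theta>) \<le> norm (qbin 1 g q k) * B" for k \<theta>
      unfolding f_def B_def norm_mult norm_cis using norm_density_factor_bound by (simp add: mult_left_mono)
    show "summable (\<lambda>k. norm (qbin 1 g q k) * B)"
      by (intro summable_mult2 qbin_norm_summable)
  qed
  moreover have "integral {0..pi} (f k) = pi * (qbin 1 g q k * qbin 1 g q (k + m))" for k
    unfolding f_def integral_mult_right integral_cis_density_factor by simp
  ultimately have "(\<lambda>k. pi * (qbin 1 g q k * qbin 1 g q (k + m))) sums integral {0..pi} (\<lambda>\<theta>. \<Sum>k. f k \<theta>)"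
    by simp
  moreover have "(\<lambda>k. pi * (qbin 1 g q k * qbin 1 g q (k + m))) sums (pi * (half_moment g q m - half_moment g q (Suc m)))"
    by (intro sums_mult half_moment_difference g q)
  ultimately show ?thesis
    unfolding eq by (rule sums_unique2)
qed

lemma continuous_on_cis_density: "continuous_on {0..pi} (\<lambda>\<theta>. cis (c * \<theta>) * rogers_density g q \<theta>)"
  by (intro continuous_on_mult continuous_on_cis_linear continuous_on_density)

lemma density_moment_neg:
  "integral {0..pi} (\<lambda>\<theta>. cis (- (2 * real m * \<theta>)) * rogers_density g q \<theta>) = pi * (half_moment g q m - half_moment g q (Suc m))"
proof -
  have "cis (- (2 * real m * \<theta>)) * rogers_density g q \<theta> = (\<lambda>\<theta>. cis (2 * real m * \<theta>) * rogers_density g q \<theta>) (pi - \<theta>)" for \<theta>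
  proof -
    have "2 * real m * (pi - \<theta>) = 2 * pi * real m + - (2 * real m * \<theta>)"
      by (simp add: algebra_simps)
    then have "cis (2 * real m * (pi - \<theta>)) = cis (2 * pi * real m) * cis (- (2 * real m * \<theta>))"
      by (simp only: cis_mult)
    also have "cis (2 * pi * real m) = 1"
      by (rule cis_multiple_2pi) simp
    finally show ?thesis by (simp add: density_reflect)
  qed
  then show ?thesis
    using integral_reflect_pi[OF continuous_on_cis_density[of "2 * real m"]] density_moment[of m] by simp
qed

text \<open>For \<open>b = q\<close> the polynomials are the Chebyshev polynomials of the second kind, sums of exponentials, and the
  moments of the weight telescope.\<close>

lemma chebyshev_integral_even:
  "integral {0..pi} (\<lambda>\<theta>. rogers_cis q q (2 * k) \<theta> * rogers_density g q \<theta>) = - 2 * pi * half_moment g q (Suc k)"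
proof (induction k)
  case 0
  have "half_moment g q 1 = - half_moment g q 0"
  proof -
    have "1 - g \<noteq> 0" by (rule one_minus_nonzero[OF g(1)])
    then have "(g - 1) / (1 - g) = - 1" by (simp add: divide_eq_eq)
    then show ?thesis using half_moment_eq[OF g q, of 1] by (simp add: qpoch_def)
  qed
  then show ?case
    using density_moment[of 0] by simp
next
  case (Suc k)
  have eq: "rogers_cis q q (2 * Suc k) \<theta> * rogers_density g q \<theta> = rogers_cis q q (2 * k) \<theta> * rogers_density g q \<theta>
      + cis (2 * real (Suc k) * \<theta>) * rogers_density g q \<theta> + cis (- (2 * real (Suc k) * \<theta>)) * rogers_density g q \<theta>" for \<theta>
    using rogers_cis_chebyshev_step[OF q, of "2 * k" \<theta>] by (simp add: algebra_simps)
  have c: "continuous_on {0..pi} (\<lambda>\<theta>. rogers_cis q q (2 * k) \<theta> * rogers_density g q \<theta>)"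
    "continuous_on {0..pi} (\<lambda>\<theta>. cis (2 * real (Suc k) * \<theta>) * rogers_density g q \<theta>)"
    "continuous_on {0..pi} (\<lambda>\<theta>. cis (- (2 * real (Suc k) * \<theta>)) * rogers_density g q \<theta>)"
    by (intro continuous_on_mult continuous_on_rogers_cis continuous_on_density continuous_intros)+
  show ?case
    unfolding eq
    by (subst integral_add integral_add | intro integrable_add integrable_continuous_real c)+
       (simp only: Suc density_moment density_moment_neg, simp add: algebra_simps)
qed

lemma rogers_integral_odd:
  assumes "odd n"
  shows "integral {0..pi} (\<lambda>\<theta>. rogers_cis b q n \<theta> * rogers_density g q \<theta>) = 0"
proof -
  have c: "continuous_on {0..pi} (\<lambda>\<theta>. rogers_cis b q n \<theta> * rogers_density g q \<theta>)"
    by (intro continuous_on_mult continuous_on_rogers_cis continuous_on_density)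
  show ?thesis
    using integral_reflect_pi[OF c, unfolded rogers_cis_reflect density_reflect] assms by simp
qed

definition mixed_moment :: "complex \<Rightarrow> nat \<Rightarrow> nat \<Rightarrow> complex" where
  "mixed_moment b m n = integral {0..pi} (\<lambda>\<theta>. rogers_cis b q m \<theta> * rogers_cis g q n \<theta> * rogers_density g q \<theta>)"

lemma mixed_moment_integrable:
  "(\<lambda>\<theta>. rogers_cis b q m \<theta> * rogers_cis g q n \<theta> * rogers_density g q \<theta>) integrable_on {0..pi}"
  by (intro integrable_continuous_real continuous_on_mult continuous_on_rogers_cis continuous_on_density)

lemma mixed_recurrence_mixed_moment: "mixed_recurrence b g q (mixed_moment b)"
  unfolding mixed_recurrence_def
proof (intro allI)
  fix m n
  define S where "S = integral {0..pi} (\<lambda>\<theta>. (cis \<theta> + cis (- \<theta>)) * rogers_cis b q m \<theta> * rogers_cis g q n \<theta> * rogers_density g q \<theta>)"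
  let ?R = "rogers_cis b q" and ?Q = "rogers_cis g q" and ?d = "rogers_density g q"
  have 1: "(1 - q ^ Suc m) * mixed_moment b (Suc m) n
      + (if m = 0 then 0 else (1 - b\<^sup>2 * q ^ (m - 1)) * mixed_moment b (m - 1) n) = (1 - b * q ^ m) * S"
  proof -
    have "(1 - q ^ Suc m) * mixed_moment b (Suc m) n
      + (if m = 0 then 0 else (1 - b\<^sup>2 * q ^ (m - 1)) * mixed_moment b (m - 1) n)
      = integral {0..pi} (\<lambda>\<theta>. (1 - q ^ Suc m) * (?R (Suc m) \<theta> * ?Q n \<theta> * ?d \<theta>)
        + (if m = 0 then 0 else 1 - b\<^sup>2 * q ^ (m - 1)) * (?R (m - 1) \<theta> * ?Q n \<theta> * ?d \<theta>))"
      unfolding mixed_moment_def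
      by (subst integral_add) (auto intro: integrable_on_mult_right mixed_moment_integrable simp del: power_Suc)
    also have "\<dots> = integral {0..pi} (\<lambda>\<theta>. (1 - b * q ^ m) * ((cis \<theta> + cis (- \<theta>)) * ?R m \<theta> * ?Q n \<theta> * ?d \<theta>))"
    proof (rule arg_cong[of _ _ "integral {0..pi}"], rule ext)
      fix \<theta>
      have "(1 - q ^ Suc m) * ?R (Suc m) \<theta> + (if m = 0 then 0 else 1 - b\<^sup>2 * q ^ (m - 1)) * ?R (m - 1) \<theta>
        = (1 - b * q ^ m) * ((cis \<theta> + cis (- \<theta>)) * ?R m \<theta>)"
        unfolding rogers_cis_recurrence[OF q, symmetric] by simp
      moreover have "A * (x * Q * d) + B * (y * Q * d) = C * (c * z * Q * d)"
        if "A * x + B * y = C * (c * z)" for A B C Q c d x y z :: complex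
        using arg_cong[OF that, of "\<lambda>t. t * (Q * d)"] by (simp only: distrib_right mult.assoc)
      ultimately show "(1 - q ^ Suc m) * (?R (Suc m) \<theta> * ?Q n \<theta> * ?d \<theta>)
        + (if m = 0 then 0 else 1 - b\<^sup>2 * q ^ (m - 1)) * (?R (m - 1) \<theta> * ?Q n \<theta> * ?d \<theta>)
        = (1 - b * q ^ m) * ((cis \<theta> + cis (- \<theta>)) * ?R m \<theta> * ?Q n \<theta> * ?d \<theta>)"
        by blast
    qed
    finally show ?thesis unfolding S_def by simp
  qed
  have 2: "(1 - q ^ Suc n) * mixed_moment b m (Suc n)
      + (if n = 0 then 0 else (1 - g\<^sup>2 * q ^ (n - 1)) * mixed_moment b m (n - 1)) = (1 - g * q ^ n) * S"
  proof -
    have "(1 - q ^ Suc n) * mixed_moment b m (Suc n)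
      + (if n = 0 then 0 else (1 - g\<^sup>2 * q ^ (n - 1)) * mixed_moment b m (n - 1))
      = integral {0..pi} (\<lambda>\<theta>. (1 - q ^ Suc n) * (?R m \<theta> * ?Q (Suc n) \<theta> * ?d \<theta>)
        + (if n = 0 then 0 else 1 - g\<^sup>2 * q ^ (n - 1)) * (?R m \<theta> * ?Q (n - 1) \<theta> * ?d \<theta>))"
      unfolding mixed_moment_def
      by (subst integral_add) (auto intro: integrable_on_mult_right mixed_moment_integrable simp del: power_Suc)
    also have "\<dots> = integral {0..pi} (\<lambda>\<theta>. (1 - g * q ^ n) * ((cis \<theta> + cis (- \<theta>)) * ?R m \<theta> * ?Q n \<theta> * ?d \<theta>))"
    proof (rule arg_cong[of _ _ "integral {0..pi}"], rule ext)
      fix \<theta>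
      have "(1 - q ^ Suc n) * ?Q (Suc n) \<theta> + (if n = 0 then 0 else 1 - g\<^sup>2 * q ^ (n - 1)) * ?Q (n - 1) \<theta>
        = (1 - g * q ^ n) * ((cis \<theta> + cis (- \<theta>)) * ?Q n \<theta>)"
        unfolding rogers_cis_recurrence[OF q, symmetric] by simp
      moreover have "A * (R * x * d) + B * (R * y * d) = C * (c * R * z * d)"
        if "A * x + B * y = C * (c * z)" for A B C R c d x y z :: complex
      proof -
        have "A * (R * x * d) + B * (R * y * d) = (A * x + B * y) * (R * d)"
          by (simp add: algebra_simps)
        then show ?thesis unfolding that by (simp add: ac_simps)
      qed
      ultimately show "(1 - q ^ Suc n) * (?R m \<theta> * ?Q (Suc n) \<theta> * ?d \<theta>)
        + (if n = 0 then 0 else 1 - g\<^sup>2 * q ^ (n - 1)) * (?R m \<theta> * ?Q (n - 1) \<theta> * ?d \<theta>)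
        = (1 - g * q ^ n) * ((cis \<theta> + cis (- \<theta>)) * ?R m \<theta> * ?Q n \<theta> * ?d \<theta>)"
        by blast
    qed
    finally show ?thesis unfolding S_def by simp
  qed
  show "((1 - q ^ Suc m) * mixed_moment b (Suc m) n
      + (if m = 0 then 0 else (1 - b\<^sup>2 * q ^ (m - 1)) * mixed_moment b (m - 1) n)) * (1 - g * q ^ n)
    = ((1 - q ^ Suc n) * mixed_moment b m (Suc n)
      + (if n = 0 then 0 else (1 - g\<^sup>2 * q ^ (n - 1)) * mixed_moment b m (n - 1))) * (1 - b * q ^ m)"
    unfolding 1 2 by (simp only: ac_simps)
qed

definition total_mass :: complex where
  "total_mass = 2 * pi * half_moment g q 0"

lemma mixed_recurrence_scale: "mixed_recurrence b g q T \<Longrightarrow> mixed_recurrence b g q (\<lambda>m n. c * T m n)"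
  unfolding mixed_recurrence_def
proof (intro allI)
  fix m n
  assume "\<forall>m n. ((1 - q ^ Suc m) * T (Suc m) n + (if m = 0 then 0 else (1 - b\<^sup>2 * q ^ (m - 1)) * T (m - 1) n)) * (1 - g * q ^ n)
    = ((1 - q ^ Suc n) * T m (Suc n) + (if n = 0 then 0 else (1 - g\<^sup>2 * q ^ (n - 1)) * T m (n - 1))) * (1 - b * q ^ m)"
  then have "c * (((1 - q ^ Suc m) * T (Suc m) n + (if m = 0 then 0 else (1 - b\<^sup>2 * q ^ (m - 1)) * T (m - 1) n)) * (1 - g * q ^ n))
    = c * (((1 - q ^ Suc n) * T m (Suc n) + (if n = 0 then 0 else (1 - g\<^sup>2 * q ^ (n - 1)) * T m (n - 1))) * (1 - b * q ^ m))"
    by simp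
  then show "((1 - q ^ Suc m) * (c * T (Suc m) n) + (if m = 0 then 0 else (1 - b\<^sup>2 * q ^ (m - 1)) * (c * T (m - 1) n))) * (1 - g * q ^ n)
    = ((1 - q ^ Suc n) * (c * T m (Suc n)) + (if n = 0 then 0 else (1 - g\<^sup>2 * q ^ (n - 1)) * (c * T m (n - 1)))) * (1 - b * q ^ m)"
    by (cases "m = 0"; cases "n = 0") (simp_all only: if_True if_False mult_zero_left mult_zero_right add_0_left add_0_right distrib_left ac_simps refl)
qed

lemma mixed_moment_chebyshev_column:
  "mixed_moment q m 0 = total_mass * (1 - g) * closed_form q g q m 0"
proof (cases "even m")
  case False
  then show ?thesis
    using rogers_integral_odd[of m q] by (simp add: mixed_moment_def closed_form_def)
next
  case True
  then obtain k where k: "m = 2 * k" by (elim evenE)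
  have "(\<Prod>i<Suc k. g - q ^ i) = (g - 1) * (\<Prod>j<k. g - q * q ^ j)"
    unfolding prod.lessThan_Suc_shift by simp
  then have "mixed_moment q m 0 = total_mass * (1 - g) * ((\<Prod>j<k. g - q * q ^ j) / qpoch g q (Suc k))"
  proof -
    have "- 2 * c * ((g - 1) * P / Q * V) = 2 * c * V * (1 - g) * (P / Q)" for c P Q V :: complex
      by (simp add: divide_inverse algebra_simps)
    then show ?thesis
      using chebyshev_integral_even[of k] half_moment_eq[OF g q, of "Suc k"]
        \<open>(\<Prod>i<Suc k. g - q ^ i) = (g - 1) * (\<Prod>j<k. g - q * q ^ j)\<close>
      unfolding mixed_moment_def k total_mass_def rogers_hom_0 mult_1_right by simp
  qed
  also have "(\<Prod>j<k. g - q * q ^ j) / qpoch g q (Suc k) = closed_form q g q m 0"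
    using closed_form_add[of q g q 0 k] qpoch_nonzero[OF q q, of k] by (simp add: k closed_form_step_def)
  finally show ?thesis .
qed

text \<open>Orthogonality (the case \<open>b = g\<close>) and Rogers' connection formula in one statement. For \<open>b = q\<close> the first column
  consists of integrals of Chebyshev polynomials, so the table is known. Its first row consists of the
  integrals of the polynomials for \<open>g\<close> alone; it is shared by the tables for all \<open>b\<close>, hence determines them.\<close>

theorem mixed_moment_eq:
  assumes "norm b < 1"
  shows "mixed_moment b m n = total_mass * (1 - g) * closed_form b g q m n"
proof -
  \<comment> \<open>with \<open>j\<close> arbitrary and \<open>i = 0\<close>, this contains the orthogonality of the polynomials for \<open>g\<close> to \<open>1\<close>\<close>
  have cheb: "mixed_moment q i j = total_mass * (1 - g) * closed_form q g q i j" for i j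
    by (rule mixed_recurrence_unique_column[OF q q mixed_recurrence_mixed_moment
          mixed_recurrence_scale[OF mixed_recurrence_closed_form[OF q g(1) q]] mixed_moment_chebyshev_column])
  have "mixed_moment b 0 j = total_mass * (1 - g) * closed_form b g q 0 j" for j
  proof -
    have "mixed_moment b 0 j = mixed_moment q 0 j" by (simp add: mixed_moment_def)
    also have "\<dots> = total_mass * (1 - g) * closed_form q g q 0 j" by (rule cheb)
    also have "closed_form q g q 0 j = closed_form b g q 0 j" by (simp add: closed_form_def closed_form_step_def)
    finally show ?thesis .
  qed
  then show ?thesis
    by (rule mixed_recurrence_unique_row[OF q g(1) mixed_recurrence_mixed_moment
          mixed_recurrence_scale[OF mixed_recurrence_closed_form[OF assms g(1) q]]])
qed

end

section \<open>The generating function and the series of the theorem\<close>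

lemma qhyp_2_1: "qhyp [a, b] [c] q z = (\<Sum>k. qpoch a q k * qpoch b q k / (qpoch q q k * qpoch c q k) * z ^ k)"
  by (simp add: qhyp_def qpochs_def)

text \<open>Reversing the order of the factors in \<open>(q\<^sup>-\<^sup>n; q)\<^sub>k\<close> and \<open>(b\<^sup>-\<^sup>1 q\<^sup>1\<^sup>-\<^sup>n; q)\<^sub>k\<close> yields the symmetric form of the
  coefficients.\<close>

lemma rogers_poly_term:
  assumes q: "norm q < 1" "q \<noteq> 0" and b: "norm b < 1" "b \<noteq> 0" and "k \<le> n"
  shows "qpoch b q n / qpoch q q n * (qpoch (q powi (- int n)) q k * qpoch b q k
      / (qpoch q q k * qpoch (inverse b * q powi (1 - int n)) q k) * (q * inverse b) ^ k)
    = qbin b 1 q k * qbin b 1 q (n - k)"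
  using \<open>k \<le> n\<close>
proof (induction k)
  case 0
  then show ?case by (simp add: qbin_one)
next
  case (Suc k)
  define m where "m = n - Suc k"
  have m: "n - k = Suc m" "n = Suc (m + k)" using Suc.prems by (auto simp: m_def)
  let ?l = "\<lambda>k. qpoch b q n / qpoch q q n * (qpoch (q powi (- int n)) q k * qpoch b q k
      / (qpoch q q k * qpoch (inverse b * q powi (1 - int n)) q k) * (q * inverse b) ^ k)"
  have e: "q powi (- int n) * q ^ k = inverse (q ^ Suc m)" "q powi (1 - int n) * q ^ k = inverse (q ^ m)"
  proof -
    have "- int n = - int (Suc m + k)" "1 - int n = - int (m + k)" by (simp_all add: m)
    then have "q powi (- int n) = inverse (q ^ (Suc m + k))" "q powi (1 - int n) = inverse (q ^ (m + k))"
      by (simp_all only: power_int_minus power_int_of_nat)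
    then show "q powi (- int n) * q ^ k = inverse (q ^ Suc m)" "q powi (1 - int n) * q ^ k = inverse (q ^ m)"
      using q(2) by (simp_all add: power_add)
  qed
  have nz: "1 - b * q ^ m \<noteq> 0" "1 - q ^ Suc k \<noteq> 0" "1 - q ^ Suc m \<noteq> 0"
    using one_minus_mult_power_nonzero[OF b(1) q(1)] one_minus_power_Suc_nonzero[OF q(1)] by blast+
  have ratio: "(1 - inverse (q ^ Suc m)) * (q * inverse b) / (1 - inverse b * inverse (q ^ m))
      = (1 - q ^ Suc m) / (1 - b * q ^ m)"
  proof -
    have 1: "(1 - inverse (q ^ Suc m)) * (q * inverse b) = (1 - q ^ Suc m) * (- inverse b * inverse (q ^ m))"
      using q(2) b(2) by (simp add: field_simps)
    have 2: "1 - inverse b * inverse (q ^ m) = (1 - b * q ^ m) * (- inverse b * inverse (q ^ m))"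
      using q(2) b(2) by (simp add: field_simps)
    have "- inverse b * inverse (q ^ m) \<noteq> 0" using q(2) b(2) by simp
    then show ?thesis unfolding 1 2 by (simp del: minus_mult_minus mult_minus_left)
  qed
  have "?l (Suc k) = ?l k * ((1 - b * q ^ k) / (1 - q ^ Suc k)
      * ((1 - inverse (q ^ Suc m)) * (q * inverse b) / (1 - inverse b * inverse (q ^ m))))"
    unfolding qpoch_Suc mult.assoc e by (simp add: divide_inverse ac_simps)
  also have "\<dots> = qbin b 1 q k * qbin b 1 q (Suc m) * ((1 - b * q ^ k) / (1 - q ^ Suc k)
      * ((1 - q ^ Suc m) / (1 - b * q ^ m)))"
    using Suc unfolding ratio m by simp
  also have "\<dots> = (qbin b 1 q k * (1 - b * q ^ k) / (1 - q ^ Suc k))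
      * (qbin b 1 q (Suc m) * (1 - q ^ Suc m) / (1 - b * q ^ m))"
    by simp
  also have "qbin b 1 q k * (1 - b * q ^ k) / (1 - q ^ Suc k) = qbin b 1 q (Suc k)"
    using qbin_Suc[OF q(1), of b 1 k] nz by (metis nonzero_mult_div_cancel_right)
  also have "qbin b 1 q (Suc m) * (1 - q ^ Suc m) / (1 - b * q ^ m) = qbin b 1 q m"
    using qbin_Suc[OF q(1), of b 1 m] nz by simp
  finally show ?case by (simp add: m_def)
qed

lemma qpoch_eq_0: "a * q ^ j = 1 \<Longrightarrow> j < n \<Longrightarrow> qpoch a q n = 0"
  by (auto simp: qpoch_def intro!: bexI[of _ j])

lemma rogers_poly_eq:
  assumes q: "norm q < 1" "q \<noteq> 0" and b: "norm b < 1" "b \<noteq> 0"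
  shows "rogers_poly n x b q = rogers_cis b q n (arccos x)"
proof -
  define \<theta> where "\<theta> = arccos x"
  let ?t = "\<lambda>k. qpoch (q powi (- int n)) q k * qpoch b q k
      / (qpoch q q k * qpoch (inverse b * q powi (1 - int n)) q k)"
  let ?z = "q * inverse b * cis (- 2 * \<theta>)"
  have zero: "?t k = 0" if "k \<notin> {..n}" for k
    using qpoch_eq_0[of "q powi (- int n)" q n k] that q(2) by (simp add: power_int_minus)
  have "qhyp [q powi (- int n), b] [inverse b * q powi (1 - int n)] q ?z = (\<Sum>k\<le>n. ?t k * ?z ^ k)"
    unfolding qhyp_2_1 by (rule suminf_finite) (simp_all add: zero)
  then have "rogers_poly n x b q = (\<Sum>k\<le>n. qpoch b q n / qpoch q q n * cis (real n * \<theta>) * (?t k * ?z ^ k))"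
    unfolding rogers_poly_def Let_def \<theta>_def[symmetric] by (simp only: sum_distrib_left)
  also have "\<dots> = rogers_cis b q n \<theta>"
    unfolding rogers_hom_def
  proof (rule sum.cong[OF refl])
    fix k assume "k \<in> {..n}"
    then have k: "k \<le> n" by simp
    have c: "cis (real n * \<theta>) * cis (- 2 * \<theta>) ^ k = cis \<theta> ^ (n - k) * cis (- \<theta>) ^ k"
      unfolding Complex.DeMoivre cis_mult using k
      by (intro arg_cong[of _ _ cis]) (simp add: of_nat_diff algebra_simps)
    have "qpoch b q n / qpoch q q n * cis (real n * \<theta>) * (?t k * ?z ^ k)
      = qpoch b q n / qpoch q q n * (?t k * (q * inverse b) ^ k) * (cis (real n * \<theta>) * cis (- 2 * \<theta>) ^ k)"
      by (simp only: power_mult_distrib ac_simps)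
    also have "\<dots> = qbin b 1 q k * qbin b 1 q (n - k) * cis \<theta> ^ (n - k) * cis (- \<theta>) ^ k"
      unfolding rogers_poly_term[OF q b k] c by (simp only: ac_simps)
    finally show "qpoch b q n / qpoch q q n * cis (real n * \<theta>) * (?t k * ?z ^ k)
      = qbin b 1 q k * qbin b 1 q (n - k) * cis \<theta> ^ (n - k) * cis (- \<theta>) ^ k" .
  qed
  finally show ?thesis by (simp only: \<theta>_def)
qed

lemma cnj_qpoch_inf:
  assumes "norm q < 1"
  shows "cnj (qpoch_inf a q) = qpoch_inf (cnj a) (cnj q)"
proof (rule LIMSEQ_unique)
  show "(\<lambda>n. cnj (qpoch a q n)) \<longlonglongrightarrow> cnj (qpoch_inf a q)"
    by (intro tendsto_cnj qpoch_tendsto_qpoch_inf assms)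
  have "cnj (qpoch a q n) = qpoch (cnj a) (cnj q) n" for n
    by (simp add: qpoch_def)
  then show "(\<lambda>n. cnj (qpoch a q n)) \<longlonglongrightarrow> qpoch_inf (cnj a) (cnj q)"
    using qpoch_tendsto_qpoch_inf[of "cnj q" "cnj a"] assms by simp
qed

lemma rogers_weight_eq:
  fixes g q :: real
  assumes "\<bar>q\<bar> < 1"
  shows "complex_of_real (rogers_weight x g q) = rogers_density g q (arccos x)"
proof -
  have "cnj (density_factor g q u) = density_factor g q (cnj u)" for u
    using assms by (simp add: density_factor_def cnj_qpoch_inf)
  then show ?thesis
    unfolding rogers_weight_def Let_def complex_norm_square
    by (simp add: rogers_density_def cis_cnj flip: density_factor_def)
qed

lemma qpoch_bound:
  assumes "norm q < 1" "norm a \<le> M"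
  shows "norm (qpoch a q n) \<le> exp (M / (1 - norm q))"
  using qprod_bound[OF assms, of 1 n] by (simp add: qpoch_def)

text \<open>The coefficients of the first series of the integrand; the second one has \<open>- s\<close> and \<open>1 / z\<close> in place of
  \<open>s\<close> and \<open>z\<close>.\<close>

definition gen_coeff :: "complex \<Rightarrow> complex \<Rightarrow> complex \<Rightarrow> nat \<Rightarrow> complex" where
  "gen_coeff s p z k = qpoch (s * z) p (2 * k) * inverse z ^ k / prod_denom s p k"

lemma prod_coeff_eq_gen_coeff:
  "prod_coeff s p n z = (\<Sum>k\<le>n. gen_coeff s p z k * gen_coeff (- s) p (inverse z) (n - k))"
  unfolding prod_coeff_def gen_coeff_def by (simp add: prod_denom_def)

lemma gen_coeff_bounded:
  assumes p: "norm p < 1" and s: "norm s < 1"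
  obtains C where "C \<ge> 0" "\<And>z k. norm z = 1 \<Longrightarrow> norm (gen_coeff s p z k) \<le> C"
    "\<And>z k. norm z = 1 \<Longrightarrow> norm (gen_coeff (- s) p z k) \<le> C"
proof -
  obtain A where A: "A > 0" "\<And>k. norm (1 / qpoch (s\<^sup>2 * p) (p\<^sup>2) k) \<le> A"
    using qpoch_inverse_bounded[of "s\<^sup>2 * p" "p\<^sup>2"] p s norm_square_less_one norm_mult_less_one by metis
  obtain B where B: "B > 0" "\<And>k. norm (1 / qpoch (p\<^sup>2) (p\<^sup>2) k) \<le> B"
    using qpoch_inverse_bounded[of "p\<^sup>2" "p\<^sup>2"] p norm_square_less_one by metis
  define E where "E = exp (norm s / (1 - norm p))"
  have main: "norm (qpoch (r * z) p (2 * k) * inverse z ^ k / prod_denom s p k) \<le> E * (A * B)"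
    if "norm z = 1" "norm r = norm s" for r z k
  proof -
    have "norm (qpoch (r * z) p (2 * k) * inverse z ^ k / prod_denom s p k)
      = norm (qpoch (r * z) p (2 * k)) * (norm (1 / qpoch (s\<^sup>2 * p) (p\<^sup>2) k) * norm (1 / qpoch (p\<^sup>2) (p\<^sup>2) k))"
      using that by (simp add: prod_denom_def norm_mult norm_divide norm_power norm_inverse)
    also have "\<dots> \<le> E * (A * B)"
      unfolding E_def using that A B
      by (intro mult_mono qpoch_bound p) (auto simp: norm_mult)
    finally show ?thesis .
  qed
  have "E * (A * B) \<ge> 0" using A B by (simp add: E_def)
  then show ?thesis
    using main[of _ s] main[of _ "- s"] by (intro that) (auto simp: gen_coeff_def prod_denom_def)
qed

lemma qhyp_gen_coeff:
  "qhyp [s * z, p * s * z] [s\<^sup>2 * p] (p\<^sup>2) (t * inverse z) = (\<Sum>k. gen_coeff s p z k * t ^ k)"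
proof -
  have "qpoch (s * z) (p\<^sup>2) k * qpoch (p * s * z) (p\<^sup>2) k = qpoch (s * z) p (2 * k)" for k
    unfolding qpoch_double by (simp only: ac_simps)
  then show ?thesis
    unfolding qhyp_2_1 gen_coeff_def prod_denom_def
    by (simp add: power_mult_distrib ac_simps)
qed

theorem generating_function:
  assumes p: "norm p < 1" "p \<noteq> 0" and s: "norm s < 1" "s \<noteq> 0" and t: "norm t < 1" and z: "norm z = 1"
  shows "(\<lambda>m. prod_norm s p m * rogers_hom (s\<^sup>2) (p\<^sup>2) m z (inverse z) * t ^ m) sums
    (qhyp [s * z, p * s * z] [s\<^sup>2 * p] (p\<^sup>2) (t * inverse z)
     * qhyp [- s * inverse z, - (p * s) * inverse z] [s\<^sup>2 * p] (p\<^sup>2) (t * z))"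
proof -
  obtain C where C: "C \<ge> 0" "\<And>z k. norm z = 1 \<Longrightarrow> norm (gen_coeff s p z k) \<le> C"
    "\<And>z k. norm z = 1 \<Longrightarrow> norm (gen_coeff (- s) p z k) \<le> C"
    using gen_coeff_bounded[OF p(1) s(1)] by blast
  have z': "norm (inverse z) = 1" "z \<noteq> 0" using z by (auto simp: norm_inverse)
  have geo: "summable (\<lambda>k. C * norm t ^ k)"
    using t by (intro summable_mult summable_geometric) simp
  have 1: "summable (\<lambda>k. norm (gen_coeff s p z k * t ^ k))"
    by (rule summable_comparison_test'[OF geo, of 0])
       (use C z in \<open>auto simp: norm_mult norm_power intro!: mult_right_mono\<close>)
  have 2: "summable (\<lambda>k. norm (gen_coeff (- s) p (inverse z) k * t ^ k))"
    by (rule summable_comparison_test'[OF geo, of 0])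
       (use C z' in \<open>auto simp: norm_mult norm_power intro!: mult_right_mono\<close>)
  have "(\<lambda>m. \<Sum>k\<le>m. gen_coeff s p z k * t ^ k * (gen_coeff (- s) p (inverse z) (m - k) * t ^ (m - k))) sums
     ((\<Sum>k. gen_coeff s p z k * t ^ k) * (\<Sum>k. gen_coeff (- s) p (inverse z) k * t ^ k))"
    by (rule Cauchy_product_sums[OF 1 2])
  also have "(\<lambda>m. \<Sum>k\<le>m. gen_coeff s p z k * t ^ k * (gen_coeff (- s) p (inverse z) (m - k) * t ^ (m - k)))
      = (\<lambda>m. prod_norm s p m * rogers_hom (s\<^sup>2) (p\<^sup>2) m z (inverse z) * t ^ m)"
  proof
    fix m
    have "(\<Sum>k\<le>m. gen_coeff s p z k * t ^ k * (gen_coeff (- s) p (inverse z) (m - k) * t ^ (m - k)))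
      = (\<Sum>k\<le>m. gen_coeff s p z k * gen_coeff (- s) p (inverse z) (m - k) * t ^ m)"
    proof (rule sum.cong[OF refl])
      fix k assume "k \<in> {..m}"
      then have "t ^ m = t ^ k * t ^ (m - k)" by (simp flip: power_add)
      then show "gen_coeff s p z k * t ^ k * (gen_coeff (- s) p (inverse z) (m - k) * t ^ (m - k))
        = gen_coeff s p z k * gen_coeff (- s) p (inverse z) (m - k) * t ^ m"
        by (simp only: ac_simps)
    qed
    then show "(\<Sum>k\<le>m. gen_coeff s p z k * t ^ k * (gen_coeff (- s) p (inverse z) (m - k) * t ^ (m - k)))
      = prod_norm s p m * rogers_hom (s\<^sup>2) (p\<^sup>2) m z (inverse z) * t ^ m"
      unfolding sum_distrib_right[symmetric] prod_coeff_eq_gen_coeff[symmetric]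
        prod_coeff_eq_rogers[OF p s z'(2)] by (simp only: inverse_eq_divide)
  qed
  finally show ?thesis
    using qhyp_gen_coeff[of s z p t] qhyp_gen_coeff[of "- s" "inverse z" p t] by simp
qed

text \<open>A summable bound, uniform on the unit circle, for the integration of the generating function term by term.\<close>

lemma generating_term_bound:
  assumes p: "norm p < 1" "p \<noteq> 0" and s: "norm s < 1" "s \<noteq> 0" and t: "norm t < 1"
  obtains M where "summable M"
    "\<And>m z. norm z = 1 \<Longrightarrow> norm (prod_norm s p m * rogers_hom (s\<^sup>2) (p\<^sup>2) m z (inverse z) * t ^ m) \<le> M m"
proof -
  obtain C where C: "C \<ge> 0" "\<And>z k. norm z = 1 \<Longrightarrow> norm (gen_coeff s p z k) \<le> C"
    "\<And>z k. norm z = 1 \<Longrightarrow> norm (gen_coeff (- s) p z k) \<le> C"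
    using gen_coeff_bounded[OF p(1) s(1)] by blast
  define M where "M m = (\<Sum>k\<le>m. (C * norm t ^ k) * (C * norm t ^ (m - k)))" for m
  have geo: "summable (\<lambda>k. norm (C * norm t ^ k))"
    using t C(1) by (simp add: abs_mult summable_mult summable_geometric)
  have "summable M"
    unfolding M_def using Cauchy_product_sums[OF geo geo] by (rule sums_summable)
  moreover have "norm (prod_norm s p m * rogers_hom (s\<^sup>2) (p\<^sup>2) m z (inverse z) * t ^ m) \<le> M m"
    if z: "norm z = 1" for m z
  proof -
    have z': "norm (inverse z) = 1" "z \<noteq> 0" using z by (auto simp: norm_inverse)
    have "norm (prod_norm s p m * rogers_hom (s\<^sup>2) (p\<^sup>2) m z (inverse z) * t ^ m)
      = norm (\<Sum>k\<le>m. gen_coeff s p z k * gen_coeff (- s) p (inverse z) (m - k) * t ^ m)"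
      unfolding sum_distrib_right[symmetric] prod_coeff_eq_gen_coeff[symmetric]
        prod_coeff_eq_rogers[OF p s z'(2)] by (simp only: inverse_eq_divide)
    also have "\<dots> \<le> M m"
      unfolding M_def
    proof (rule sum_norm_le)
      fix k assume "k \<in> {..m}"
      then have tm: "norm t ^ m = norm t ^ k * norm t ^ (m - k)" by (simp flip: power_add)
      have "norm (gen_coeff s p z k * gen_coeff (- s) p (inverse z) (m - k) * t ^ m) \<le> C * C * norm t ^ m"
        unfolding norm_mult norm_power using C z z' by (intro mult_mono) auto
      then show "norm (gen_coeff s p z k * gen_coeff (- s) p (inverse z) (m - k) * t ^ m)
        \<le> C * norm t ^ k * (C * norm t ^ (m - k))"
        unfolding tm by (simp only: ac_simps)
    qed
    finally show ?thesis .
  qed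
  ultimately show ?thesis using that by blast
qed

lemma qpoch_pm: "qpoch c q k * qpoch (- c) q k = qpoch (c\<^sup>2) (q\<^sup>2) k"
  by (simp add: qpoch_def power2_eq_square power_mult_distrib algebra_simps flip: prod.distrib)

text \<open>Every pair of square roots with both signs in the series of the theorem arises from splitting a symbol
  of index \<open>n + 2 k\<close> in this way.\<close>

lemma qpoch_add_double:
  assumes "c\<^sup>2 = a * q ^ n" "d\<^sup>2 = a * q ^ (n + 1)"
  shows "qpoch a q (n + 2 * k) = qpoch a q n * (qpoch c q k * (qpoch (- c) q k * (qpoch d q k * qpoch (- d) q k)))"
proof -
  have "qpoch c q k * (qpoch (- c) q k * (qpoch d q k * qpoch (- d) q k)) = qpoch (a * q ^ n) q (2 * k)"
    unfolding mult.assoc[symmetric] qpoch_pm mult.assoc[of _ "qpoch d q k"] assms qpoch_double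
    by (simp add: ac_simps)
  then show ?thesis by (simp add: qpoch_add)
qed

lemma qprod_eq_qpoch:
  assumes "c \<noteq> 0"
  shows "(\<Prod>j<k. c - b * q ^ j) = c ^ k * qpoch (b * inverse c) q k"
proof -
  have "(\<Prod>j<k. c - b * q ^ j) = (\<Prod>j<k. c * (1 - b * inverse c * q ^ j))"
    using assms by (intro prod.cong) (auto simp: field_simps)
  then show ?thesis by (simp add: prod.distrib qpoch_def)
qed

definition Phi_term :: "nat \<Rightarrow> complex \<Rightarrow> complex \<Rightarrow> complex \<Rightarrow> complex \<Rightarrow> nat \<Rightarrow> complex" where
  "Phi_term n b g q t k =
    qpochs ([b * inverse g, b * q ^ n]
      @ pm (\<i> * csqrt (b * q ^ n))
      @ pm (\<i> * csqrt (b * q ^ (n + 1)))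
      @ pm (\<i> * csqrt (b * csqrt q ^ (2 * n + 1)))
      @ pm (\<i> * csqrt (b * csqrt q ^ (2 * n + 3)))) q k
       / qpochs (q # ([g * q ^ (n + 1)]
      @ pm (b * csqrt q ^ n)
      @ pm (b * csqrt q ^ (n + 1))
      @ pm (csqrt (b * csqrt q ^ (2 * n + 1)))
      @ pm (csqrt (b * csqrt q ^ (2 * n + 3))))) q k * (g * t\<^sup>2) ^ k"

lemma Phi_series_eq: "Phi_series n b g q t = (\<Sum>k. Phi_term n b g q t k)"
  unfolding Phi_series_def Phi_term_def qhyp_def by simp

lemma Phi_series_term:
  fixes b g q t p :: complex
  assumes p: "p = csqrt q" and s: "s\<^sup>2 = b" and g: "g \<noteq> 0" "norm g < 1" and q: "norm q < 1"
  shows "prod_norm s p (n + 2 * k) * ((1 - g) * closed_form_step b g q n k) * t ^ (n + 2 * k)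
    = t ^ n * qpochs ([g\<^sup>2] @ pm b @ [- b * csqrt q]) q n / qpochs [b\<^sup>2, b * csqrt q, q * g, q] q n
      * Phi_term n b g q t k"
proof -
  have p2: "p\<^sup>2 = q" by (simp add: p)
  have odd: "p ^ (2 * n + 1) = p * q ^ n" "p ^ (2 * n + 3) = p * q ^ (n + 1)"
    by (simp_all add: p2[symmetric] power_add power_mult power2_eq_square power3_eq_cube)
  have b4: "s ^ 4 = b\<^sup>2" using s by (simp add: power2_eq_square power4_eq_xxxx mult.assoc)
  have s1: "qpoch (- b) q (n + 2 * k) = qpoch (- b) q n
      * (qpoch (\<i> * csqrt (b * q ^ n)) q k * (qpoch (- (\<i> * csqrt (b * q ^ n))) q k
      * (qpoch (\<i> * csqrt (b * q ^ (n + 1))) q k * qpoch (- (\<i> * csqrt (b * q ^ (n + 1)))) q k)))"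
    by (rule qpoch_add_double) (simp_all add: power_mult_distrib)
  have s2: "qpoch (- b * p) q (n + 2 * k) = qpoch (- b * p) q n
      * (qpoch (\<i> * csqrt (b * p ^ (2 * n + 1))) q k * (qpoch (- (\<i> * csqrt (b * p ^ (2 * n + 1)))) q k
      * (qpoch (\<i> * csqrt (b * p ^ (2 * n + 3))) q k * qpoch (- (\<i> * csqrt (b * p ^ (2 * n + 3)))) q k)))"
    unfolding odd by (rule qpoch_add_double) (simp_all add: power_mult_distrib)
  have s3: "qpoch (b\<^sup>2) q (n + 2 * k) = qpoch (b\<^sup>2) q n
      * (qpoch (b * p ^ n) q k * (qpoch (- (b * p ^ n)) q k
      * (qpoch (b * p ^ (n + 1)) q k * qpoch (- (b * p ^ (n + 1))) q k)))"
  proof (rule qpoch_add_double)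
    have "(p ^ i)\<^sup>2 = q ^ i" for i
      unfolding p2[symmetric] power_mult[symmetric] by (simp only: mult.commute)
    then show "(b * p ^ n)\<^sup>2 = b\<^sup>2 * q ^ n" "(b * p ^ (n + 1))\<^sup>2 = b\<^sup>2 * q ^ (n + 1)"
      by (simp_all only: power_mult_distrib)
  qed
  have s4: "qpoch (b * p) q (n + 2 * k) = qpoch (b * p) q n
      * (qpoch (csqrt (b * p ^ (2 * n + 1))) q k * (qpoch (- csqrt (b * p ^ (2 * n + 1))) q k
      * (qpoch (csqrt (b * p ^ (2 * n + 3))) q k * qpoch (- csqrt (b * p ^ (2 * n + 3))) q k)))"
    unfolding odd by (rule qpoch_add_double) simp_all
  have pn: "prod_norm s p (n + 2 * k) = qpoch (- b) q (n + 2 * k) * qpoch (- b * p) q (n + 2 * k)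
      / (qpoch (b\<^sup>2) q (n + 2 * k) * qpoch (b * p) q (n + 2 * k))"
    unfolding prod_norm_def b4 s qpoch_double p2 ..
  have g1: "1 - g \<noteq> 0" by (rule one_minus_nonzero[OF g(2)])
  have "qpoch g q (Suc (n + k)) = (1 - g) * (qpoch (q * g) q n * qpoch (g * q ^ (n + 1)) q k)"
    unfolding qpoch_shift qpoch_add by (simp add: ac_simps)
  then have cc: "(1 - g) * closed_form_step b g q n k = qpoch (g\<^sup>2) q n / qpoch q q n * (g ^ k * qpoch (b * inverse g) q k)
      * (qpoch b q n * qpoch (b * q ^ n) q k) / (qpoch q q k * (qpoch (q * g) q n * qpoch (g * q ^ (n + 1)) q k))"
    unfolding closed_form_step_def qprod_eq_qpoch[OF g(1)] qpoch_add using g1 by simp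
  have tt: "t ^ (n + 2 * k) = t ^ n * (t\<^sup>2) ^ k"
    by (simp add: power_add power_mult)
  show ?thesis
    unfolding Phi_term_def pn cc tt p[symmetric] s1 s2 s3 s4
    by (simp add: qpochs_def power_mult_distrib divide_inverse ac_simps)
qed

section \<open>Integration over the interval\<close>

text \<open>The substitution \<open>x = cos \<theta>\<close> is carried out with the increasing function \<open>arcsin\<close>. Its derivative is
  integrable although unbounded, and \<open>F\<close> is bounded.\<close>

lemma interval_integral_arccos:
  fixes F :: "real \<Rightarrow> complex"
  assumes F: "continuous_on {0..pi} F"
  shows "interval_lebesgue_integrable lborel (-1) 1 (\<lambda>x. F (arccos x) * complex_of_real (1 / sqrt (1 - x\<^sup>2)))"
    and "(LBINT x=-1..1. F (arccos x) * complex_of_real (1 / sqrt (1 - x\<^sup>2))) = integral {0..pi} F"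
proof -
  define w where "w x = 1 / sqrt (1 - x\<^sup>2)" for x :: real
  define f where "f y = F (pi / 2 - y)" for y
  have f: "continuous_on {- (pi / 2)..pi / 2} f"
    unfolding f_def by (rule continuous_on_compose2[OF F]) (auto intro!: continuous_intros)
  have f_arcsin: "f (arcsin x) = F (arccos x)" if "x \<in> {-1<..<1}" for x
    using that by (simp add: f_def arccos_arcsin_eq)
  have sq: "1 - x\<^sup>2 > 0" if "x \<in> {-1<..<1}" for x :: real
    using that by (simp add: abs_square_less_1 abs_less_iff)
  have cw: "isCont w x" if "x \<in> {-1<..<1}" for x
    unfolding w_def using sq[OF that] by (intro continuous_intros) auto
  have w0: "w x \<ge> 0" if "x \<in> {-1..1}" for x
    using that by (simp add: w_def abs_square_le_1 abs_le_iff)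
  have deriv: "DERIV arcsin x :> w x" if "x \<in> {-1<..<1}" for x
    using DERIV_arcsin[of x] that by (simp add: w_def divide_inverse)
  have lim: "(arcsin \<longlongrightarrow> - (pi / 2)) (at_right (-1))" "(arcsin \<longlongrightarrow> pi / 2) (at_left 1)"
    using continuous_on_arcsin' by (auto simp: continuous_on_Icc_at_rightD continuous_on_Icc_at_leftD
        dest: continuous_on_Icc_at_rightD continuous_on_Icc_at_leftD)
  have wi: "set_integrable lborel (einterval (ereal (-1)) (ereal 1)) w"
  proof (rule interval_integral_FTC_nonneg(1)[where F = arcsin])
    show "((arcsin \<circ> real_of_ereal) \<longlongrightarrow> - (pi / 2)) (at_right (ereal (-1)))"
      "((arcsin \<circ> real_of_ereal) \<longlongrightarrow> pi / 2) (at_left (ereal 1))"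
      unfolding ereal_tendsto_simps1 using lim by auto
    show "AE x in lborel. ereal (-1) < ereal x \<longrightarrow> ereal x < ereal 1 \<longrightarrow> 0 \<le> w x"
      using w0 by (intro AE_I2) auto
  qed (use deriv cw in auto)
  obtain B where B: "\<And>\<theta>. \<theta> \<in> {0..pi} \<Longrightarrow> norm (F \<theta>) \<le> B"
    using compact_imp_bounded[OF compact_continuous_image[OF F compact_Icc]] unfolding bounded_iff by (meson imageI)
  have cF: "continuous_on {-1<..<1} (\<lambda>x. F (arccos x) * complex_of_real (w x))"
  proof (intro continuous_on_mult continuous_on_of_real)
    show "continuous_on {-1<..<1} (\<lambda>x. F (arccos x))"
      by (rule continuous_on_compose2[OF F continuous_on_subset[OF continuous_on_arccos']])
         (auto intro!: arccos_lbound arccos_ubound)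
    show "continuous_on {-1<..<1} w"
      using cw by (intro continuous_at_imp_continuous_on) auto
  qed
  have int: "set_integrable lborel {-1<..<1} (\<lambda>x. F (arccos x) * complex_of_real (w x))"
  proof (rule set_integrable_bound[where f = "\<lambda>x. B * w x"])
    show "set_integrable lborel {-1<..<1} (\<lambda>x. B * w x)"
      using wi by (intro set_integrable_mult_right) auto
    show "set_borel_measurable lborel {-1<..<1} (\<lambda>x. F (arccos x) * complex_of_real (w x))"
      unfolding set_borel_measurable_def
      using borel_measurable_continuous_on_indicator[OF _ cF] by simp
    show "AE x in lborel. x \<in> {-1<..<1} \<longrightarrow> norm (F (arccos x) * complex_of_real (w x)) \<le> norm (B * w x)"
    proof (intro AE_I2 impI)
      fix x :: real assume x: "x \<in> {-1<..<1}"
      then have "norm (F (arccos x)) \<le> B"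
        by (intro B) (auto intro!: arccos_lbound arccos_ubound)
      then show "norm (F (arccos x) * complex_of_real (w x)) \<le> norm (B * w x)"
        by (auto simp: norm_mult abs_mult intro!: mult_right_mono)
    qed
  qed
  have ends: "- 1 = ereal (-1)" "1 = ereal 1" by (simp_all add: one_ereal_def)
  show "interval_lebesgue_integrable lborel (-1) 1 (\<lambda>x. F (arccos x) * complex_of_real (1 / sqrt (1 - x\<^sup>2)))"
    unfolding ends interval_lebesgue_integrable_def using int by (simp add: w_def)
  have eq: "f (arcsin x) * complex_of_real (w x) = F (arccos x) * complex_of_real (w x)" if "x \<in> {-1<..<1}" for x
    using f_arcsin[OF that] by simp
  have "(LBINT y=ereal (- (pi / 2))..ereal (pi / 2). f y) = (LBINT x=ereal (-1)..ereal 1. w x *\<^sub>R f (arcsin x))"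
  proof (rule interval_integral_substitution_integrable)
    show "isCont f (arcsin x)" if "ereal (-1) < ereal x" "ereal x < ereal 1" for x
      using arcsin_lt_bounded[of x] that
      by (intro continuous_on_interior[OF f]) (auto simp: interior_atLeastAtMost_real)
    show "((ereal \<circ> arcsin \<circ> real_of_ereal) \<longlongrightarrow> ereal (- (pi / 2))) (at_right (ereal (-1)))"
      "((ereal \<circ> arcsin \<circ> real_of_ereal) \<longlongrightarrow> ereal (pi / 2)) (at_left (ereal 1))"
      unfolding ereal_tendsto_simps1 ereal_tendsto_simps2 using lim by auto
    show "set_integrable lborel (einterval (ereal (-1)) (ereal 1)) (\<lambda>x. w x *\<^sub>R f (arcsin x))"
      using int by (subst set_integrable_cong[OF refl refl])
        (auto simp: scaleR_conv_of_real f_arcsin mult.commute)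
    show "set_integrable lborel (einterval (ereal (- (pi / 2))) (ereal (pi / 2))) f"
      by (rule set_integrable_subset[OF borel_integrable_atLeastAtMost'[OF f]]) auto
  qed (use deriv cw w0 in auto)
  also have "\<dots> = (LBINT x=ereal (-1)..ereal 1. F (arccos x) * complex_of_real (w x))"
    by (rule interval_integral_cong) (auto simp: scaleR_conv_of_real f_arcsin mult.commute)
  also have "(LBINT y=ereal (- (pi / 2))..ereal (pi / 2). f y) = integral {- (pi / 2)..pi / 2} f"
    by (rule interval_integral_eq_integral) (auto intro: borel_integrable_atLeastAtMost' f)
  also have "\<dots> = integral {0..pi} F"
  proof -
    have "(F has_integral integral {0..pi} F) (cbox 0 pi)"
      using F by (simp add: integrable_integral integrable_continuous_real)
    from has_integral_affinity[OF this, of "-1" "pi / 2"]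
    have "(f has_integral integral {0..pi} F) ((\<lambda>x. pi / 2 - x) ` {0..pi})"
      by (simp add: f_def [abs_def])
    moreover have "(\<lambda>x. pi / 2 - x) ` {0..pi} = {- (pi / 2)..pi / 2}"
      by (auto simp: image_iff intro: bexI[of _ "pi / 2 - _"])
    ultimately show ?thesis by (auto dest: integral_unique)
  qed
  finally show "(LBINT x=-1..1. F (arccos x) * complex_of_real (1 / sqrt (1 - x\<^sup>2))) = integral {0..pi} F"
    unfolding ends by (simp add: w_def)
qed

theorem corollary22:
  fixes n :: nat and \<beta> \<gamma> q :: real and t :: complex
  assumes "\<beta> \<in> {-1<..<1} - {0}" and "\<gamma> \<in> {-1<..<1} - {0}"
    and "0 < \<bar>q\<bar>" and "\<bar>q\<bar> < 1"
    and "cmod t < min (cmod ((1 - \<beta>\<^sup>2) * (1 + csqrt q * \<bar>\<beta>\<bar>) * (1 - q * \<bar>\<gamma>\<bar>))) 1"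
  shows "interval_lebesgue_integrable lborel (-1) 1 (rogers_integrand n \<beta> \<gamma> q t)
    \<and> (LBINT x=-1..1. rogers_integrand n \<beta> \<gamma> q t x) =
      2 * pi * t ^ n
      * (qpochs_inf [\<gamma>, q * \<gamma>] q * qpochs ([\<gamma>\<^sup>2] @ pm \<beta> @ [- \<beta> * csqrt q]) q n)
      / (qpochs_inf [\<gamma>\<^sup>2, q] q * qpochs [\<beta>\<^sup>2, \<beta> * csqrt q, q * \<gamma>, q] q n)
      * Phi_series n \<beta> \<gamma> q t"
proof -
  define b g Q p s where "b = complex_of_real \<beta>" and "g = complex_of_real \<gamma>" and "Q = complex_of_real q"
    and "p = csqrt Q" and "s = csqrt b"
  have p2: "p\<^sup>2 = Q" and s2: "s\<^sup>2 = b" by (simp_all add: p_def s_def)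
  have b: "norm b < 1" "b \<noteq> 0" and g: "norm g < 1" "g \<noteq> 0" and Q: "norm Q < 1" "Q \<noteq> 0"
    using assms by (auto simp: b_def g_def Q_def)
  have root: "norm r < 1 \<and> r \<noteq> 0" if "norm (r\<^sup>2) < 1" "r\<^sup>2 \<noteq> 0" for r :: complex
    using that by (simp add: norm_power power_less_one_iff)
  have p: "norm p < 1" "p \<noteq> 0" using root[of p] Q by (auto simp: p2)
  have s: "norm s < 1" "s \<noteq> 0" using root[of s] b by (auto simp: s2)
  have t: "norm t < 1" using assms(5) by simp
  let ?R = "rogers_cis b Q" and ?G = "rogers_cis g Q"
  define h where "h m \<theta> = prod_norm s p m * ?R m \<theta> * t ^ m * (?G n \<theta> * rogers_density g Q \<theta>)" for m \<theta>
  define F where "F \<theta> = (\<Sum>m. h m \<theta>)" for \<theta>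
  have F: "F \<theta> = qhyp [s * cis \<theta>, p * s * cis \<theta>] [b * p] Q (t * cis (- \<theta>))
      * qhyp [- s * cis (- \<theta>), - (p * s) * cis (- \<theta>)] [b * p] Q (t * cis \<theta>) * (?G n \<theta> * rogers_density g Q \<theta>)" for \<theta>
    unfolding F_def h_def
    using sums_mult2[OF generating_function[OF p s t, of "cis \<theta>"], of "?G n \<theta> * rogers_density g Q \<theta>"]
    by (simp add: sums_iff s2 p2 cis_inverse)
  have integrand: "rogers_integrand n \<beta> \<gamma> q t x = F (arccos x) * complex_of_real (1 / sqrt (1 - x\<^sup>2))" for x
  proof -
    have "complex_of_real (rogers_weight x \<gamma> q / sqrt (1 - x\<^sup>2))
      = rogers_density g Q (arccos x) * complex_of_real (1 / sqrt (1 - x\<^sup>2))"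
      using rogers_weight_eq[of q x \<gamma>] assms(4) by (simp add: g_def Q_def)
    moreover have "rogers_poly n x g Q = ?G n (arccos x)"
      by (rule rogers_poly_eq[OF Q g])
    ultimately show ?thesis
      unfolding rogers_integrand_def Let_def F b_def[symmetric] g_def[symmetric] Q_def[symmetric]
        p_def[symmetric] s_def[symmetric] by (simp only: ac_simps)
  qed
  obtain M where M: "summable M"
    "\<And>m z. norm z = 1 \<Longrightarrow> norm (prod_norm s p m * rogers_hom b Q m z (inverse z) * t ^ m) \<le> M m"
    using generating_term_bound[OF p s t] unfolding s2 p2 by blast
  have cG: "continuous_on {0..pi} (\<lambda>\<theta>. ?G n \<theta> * rogers_density g Q \<theta>)"
    by (intro continuous_on_mult continuous_on_rogers_cis continuous_on_density g Q)
  obtain B where B: "\<And>\<theta>. \<theta> \<in> {0..pi} \<Longrightarrow> norm (?G n \<theta> * rogers_density g Q \<theta>) \<le> B"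
    using compact_imp_bounded[OF compact_continuous_image[OF cG compact_Icc]] unfolding bounded_iff by (meson imageI)
  have h: "continuous_on {0..pi} (h m)" for m
    unfolding h_def by (intro continuous_on_mult[OF _ cG] continuous_on_mult continuous_on_const continuous_on_rogers_cis)
  have bound: "norm (h m \<theta>) \<le> M m * B" if "\<theta> \<in> {0..pi}" for m \<theta>
    unfolding h_def norm_mult[of _ "?G n \<theta> * rogers_density g Q \<theta>"]
    using M(2)[of "cis \<theta>" m] B[OF that] order_trans[OF norm_ge_zero M(2)[of "cis \<theta>" m]]
    by (intro mult_mono) (auto simp: cis_inverse)
  note summable_MB = summable_mult2[OF M(1), of B]
  have contF: "continuous_on {0..pi} F"
    unfolding F_def by (rule sums_integral_uniform(1)[OF h bound summable_MB])
  have "(\<lambda>m. integral {0..pi} (h m)) sums integral {0..pi} F"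
    unfolding F_def by (rule sums_integral_uniform(2)[OF h bound summable_MB])
  moreover have int_h: "integral {0..pi} (h m)
      = total_mass g Q * (prod_norm s p m * ((1 - g) * closed_form b g Q m n) * t ^ m)" for m
  proof -
    have "h m = (\<lambda>\<theta>. prod_norm s p m * t ^ m * (?R m \<theta> * ?G n \<theta> * rogers_density g Q \<theta>))"
      by (simp add: h_def fun_eq_iff)
    then have "integral {0..pi} (h m) = prod_norm s p m * t ^ m * mixed_moment g Q b m n"
      unfolding mixed_moment_def[OF g Q(1)] by simp
    then show ?thesis
      unfolding mixed_moment_eq[OF g Q(1) b(1)] by (simp only: ac_simps)
  qed
  ultimately have "(\<lambda>m. total_mass g Q * (prod_norm s p m * ((1 - g) * closed_form b g Q m n) * t ^ m)) sums integral {0..pi} F"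
    by simp
  moreover have "closed_form b g Q m n = 0" if "m \<notin> range (\<lambda>k. n + 2 * k)" for m
  proof -
    have "\<not> (n \<le> m \<and> even (m - n))"
    proof
      assume "n \<le> m \<and> even (m - n)"
      then have "n \<le> m" and "even (m - n)" by blast+
      then obtain k where "m - n = 2 * k" by blast
      then have "m = n + 2 * k" using \<open>n \<le> m\<close> by simp
      then show False using that by blast
    qed
    then show ?thesis unfolding closed_form_def by (rule if_not_P)
  qed
  ultimately have "(\<lambda>k. total_mass g Q * (prod_norm s p (n + 2 * k) * ((1 - g) * closed_form b g Q (n + 2 * k) n) * t ^ (n + 2 * k)))
      sums integral {0..pi} F"
    by (subst sums_mono_reindex[of "\<lambda>k. n + 2 * k"]) (auto simp: strict_mono_def)
  then have sums: "(\<lambda>k. total_mass g Q * (prod_norm s p (n + 2 * k) * ((1 - g) * closed_form_step b g Q n k) * t ^ (n + 2 * k)))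
      sums integral {0..pi} F"
    by (simp only: closed_form_add)
  define c where "c = t ^ n * qpochs ([g\<^sup>2] @ pm b @ [- b * csqrt Q]) Q n / qpochs [b\<^sup>2, b * csqrt Q, Q * g, Q] Q n"
  let ?\<phi> = "Phi_term n b g Q t"
  have summand: "prod_norm s p (n + 2 * k) * ((1 - g) * closed_form_step b g Q n k) * t ^ (n + 2 * k) = c * ?\<phi> k" for k
    unfolding Phi_series_term[OF p_def s2 g(2,1) Q(1)] c_def ..
  have "integral {0..pi} F = total_mass g Q * c * Phi_series n b g Q t"
  \<comment> \<open>the factor contains \<open>t ^ n\<close> and may vanish; if not, it can be cancelled to see that the series converges\<close>
  proof (cases "total_mass g Q * c = 0")
    case True
    then show ?thesis using sums by (auto simp: summand sums_iff)
  next
    case False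
    have *: "(\<lambda>k. total_mass g Q * c * ?\<phi> k) sums integral {0..pi} F"
      using sums[unfolded summand] unfolding mult.assoc .
    then have "summable ?\<phi>"
      using False by (metis sums_summable summable_cmult_iff)
    then show ?thesis
      using suminf_mult[of ?\<phi> "total_mass g Q * c"] * by (simp add: Phi_series_eq sums_iff)
  qed
  also have "total_mass g Q = 2 * pi * (qpochs_inf [g, Q * g] Q / qpochs_inf [g\<^sup>2, Q] Q)"
    unfolding total_mass_def[OF g Q(1)] half_moment_0[OF g Q(1)] by (simp add: qpochs_inf_def)
  finally have integral_F: "integral {0..pi} F = 2 * pi * t ^ n
      * (qpochs_inf [g, Q * g] Q * qpochs ([g\<^sup>2] @ pm b @ [- b * csqrt Q]) Q n)
      / (qpochs_inf [g\<^sup>2, Q] Q * qpochs [b\<^sup>2, b * csqrt Q, Q * g, Q] Q n)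
      * Phi_series n b g Q t"
    by (simp add: c_def)
  have integrand': "rogers_integrand n \<beta> \<gamma> q t = (\<lambda>x. F (arccos x) * complex_of_real (1 / sqrt (1 - x\<^sup>2)))"
    by (rule ext) (rule integrand)
  show ?thesis
    unfolding integrand' interval_integral_arccos(2)[OF contF] integral_F
    using interval_integral_arccos(1)[OF contF] by (simp add: b_def g_def Q_def)
qed

end
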